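(* Let $a\ge 1$, $b\ge 0$ be integers and let $\nu=NE^{\nu_1}NE^{\nu_2}\cdots NE^{\nu_a}$ be a lattice path from $(0,0)$ to $(b,a)$. The $h^*$-polynomial of the flow polytope $\mathcal{F}_{\mathrm{car}(\nu)}$ is the $\nu$-Narayana polynomial $N_\nu(x)$.
   Context: Lattice paths use north steps $N=(0,1)$ and east steps $E=(1,0)$. Here $\nu=NE^{\nu_1}\cdots NE^{\nu_a}$ with integers $\nu_i\ge 0$ and $\sum_i \nu_i=b$. A $\nu$-Dyck path is a lattice path from $(0,0)$ to $(b,a)$ that lies weakly above $\nu$. A valley of a lattice path is a consecutive $EN$ pair of steps. The $\nu$-Narayana number $\mathrm{Nar}_\nu(i)$ is the number of $\nu$-Dyck paths with exactly $i$ valleys, and the $\nu$-Narayana polynomial is $N_\nu(x)=\sum_{i\ge 0}\mathrm{Nar}_\nu(i)x^i$. The $\nu$-caracol graph $\mathrm{car}(\nu)$ is the directed multigraph on the vertex set $\{1,\dots,a+3\}$, all edges $(i,j)$ directed from $i$ to $j$ with $i<j$, having exactly these edges: $\nu_i$ copies of $(1,i+2)$ for $i=1,\dots,a$; one edge $(i,a+3)$ for each $i=2,\dots,a+1$; one edge $(i,i+1)$ for each $i=1,\dots,a+2$. Write $n+1=a+3$ and let $m=2a+b+2$ be the number of edges. The flow polytope $\mathcal{F}_{\mathrm{car}(\nu)}\subset\mathbb{R}^m$ is the set of nonnegative tuples $(x_e)_e$ indexed by edges with $\sum_{e\in \mathrm{out}(1)}x_e=1$ and $\sum_{e\in\mathrm{out}(j)}x_e=\sum_{e\in\mathrm{in}(j)}x_e$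 for $j=2,\dots,n$. It is a lattice polytope of dimension $a+b$. The $h^*$-polynomial of a $d$-dimensional lattice polytope $P\subset\mathbb{R}^m$ is the polynomial $h^*(x)$ defined by $\sum_{t\ge 0}|tP\cap\mathbb{Z}^m|\,x^t=h^*(x)/(1-x)^{d+1}$. *)

theory Defs
  imports
    "HOL-Analysis.Analysis"
    "HOL-Computational_Algebra.Polynomial_FPS"
    "Graph_Theory.Digraph"
begin

section \<open>Lattice paths and Narayana polynomials\<close>

text \<open>Lattice paths start at the origin and are represented by their list of steps.\<close>

datatype step = North | East

type_synonym lattice_path = "step list"

definition endpoint :: "lattice_path \<Rightarrow> nat \<times> nat" where
  "endpoint p = (count_list p East, count_list p North)"

definition lattice_points :: "lattice_path \<Rightarrow> (nat \<times> nat) set" where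
  "lattice_points p = {endpoint (take k p) | k. k \<le> length p}"

text \<open>
  Every lattice point of \<open>p\<close> lies on or vertically above a lattice point of \<open>q\<close>.  For two
  paths with the same endpoints, checking lattice points suffices, since the heights of
  both paths are constant over the interior of each unit interval.
\<close>

definition weakly_above :: "lattice_path \<Rightarrow> lattice_path \<Rightarrow> bool" where
  "weakly_above p q \<longleftrightarrow>
     (\<forall>(x, y) \<in> lattice_points p. \<exists>y'. (x, y') \<in> lattice_points q \<and> y' \<le> y)"

definition dyck_paths :: "lattice_path \<Rightarrow> lattice_path set" where
  "dyck_paths \<mu> = {p. endpoint p = endpoint \<mu> \<and> weakly_above p \<mu>}"

definition valleys :: "lattice_path \<Rightarrow> nat set" where
  "valleys p = {i. i + 1 < length p \<and> p ! i = East \<and> p ! (i + 1) = North}"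

definition narayana :: "lattice_path \<Rightarrow> nat \<Rightarrow> nat" where
  "narayana \<mu> i = card {p \<in> dyck_paths \<mu>. card (valleys p) = i}"

text \<open>
  The bound \<open>length \<mu>\<close> loses no terms, as shown in \<open>coeff_narayana_poly\<close> below.
\<close>

definition narayana_poly :: "lattice_path \<Rightarrow> real poly" where
  "narayana_poly \<mu> = (\<Sum>i\<le>length \<mu>. monom (of_nat (narayana \<mu> i)) i)"

text \<open>The path $NE^{\nu_1} NE^{\nu_2} \cdots NE^{\nu_a}$.\<close>

definition nu_path :: "nat \<Rightarrow> (nat \<Rightarrow> nat) \<Rightarrow> lattice_path" where
  "nu_path a \<nu> = concat (map (\<lambda>i. North # replicate (\<nu> i) East) [1..<a + 1])"

lemma length_eq_counts: "length p = count_list p East + count_list p North"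
proof (induction p)
  case (Cons s p)
  then show ?case by (cases s) auto
qed simp

lemma coeff_narayana_poly: "coeff (narayana_poly \<mu>) i = of_nat (narayana \<mu> i)"
proof (cases "i \<le> length \<mu>")
  case True
  then show ?thesis
    by (simp add: narayana_poly_def coeff_sum if_distrib sum.delta cong: if_cong)
next
  case False
  have "card (valleys p) \<noteq> i" if "p \<in> dyck_paths \<mu>" for p
  proof -
    have "length p = length \<mu>"
      using that by (simp add: dyck_paths_def endpoint_def length_eq_counts)
    moreover have "card (valleys p) \<le> card {..<length p}"
      by (rule card_mono) (auto simp: valleys_def)
    ultimately show ?thesis using False by simp
  qed
  then have "{p \<in> dyck_paths \<mu>. card (valleys p) = i} = {}" by blast
  then have "narayana \<mu> i = 0" by (simp only: narayana_def card.empty)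
  with False show ?thesis
    by (simp add: narayana_poly_def coeff_sum)
qed

lemma finite_dyck_paths: "finite (dyck_paths \<mu>)"
proof (rule finite_subset)
  show "dyck_paths \<mu> \<subseteq> {p. set p \<subseteq> {North, East} \<and> length p = length \<mu>}"
    by (auto simp: dyck_paths_def endpoint_def length_eq_counts intro: step.exhaust)
  show "finite {p. set p \<subseteq> {North, East} \<and> length p = length \<mu>}"
    by (rule finite_lists_length_eq) simp
qed

section \<open>The caracol graph\<close>

text \<open>
  \<open>Init i k\<close> is the \<open>k\<close>-th copy of the edge \<open>(1, i + 2)\<close>, \<open>Final i\<close> is the edge \<open>(i, a + 3)\<close>
  and \<open>Path i\<close> is the edge \<open>(i, i + 1)\<close>.
\<close>

datatype car_edge = Init nat nat | Final nat | Path nat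

fun car_tail :: "car_edge \<Rightarrow> nat" where
  "car_tail (Init i k) = 1"
| "car_tail (Final i) = i"
| "car_tail (Path i) = i"

fun car_head :: "nat \<Rightarrow> car_edge \<Rightarrow> nat" where
  "car_head a (Init i k) = i + 2"
| "car_head a (Final i) = a + 3"
| "car_head a (Path i) = i + 1"

definition car :: "nat \<Rightarrow> (nat \<Rightarrow> nat) \<Rightarrow> (nat, car_edge) pre_digraph" where
  "car a \<nu> =
    \<lparr>verts = {1..a + 3},
     arcs = {Init i k | i k. i \<in> {1..a} \<and> k \<in> {1..\<nu> i}} \<union> Final ` {2..a + 1} \<union> Path ` {1..a + 2},
     tail = car_tail,
     head = car_head a\<rparr>"

lemma fin_digraph_car: "fin_digraph (car a \<nu>)"
proof
  have "{Init i k | i k. i \<in> {1..a} \<and> k \<in> {1..\<nu> i}} = (\<lambda>(i, k). Init i k) ` (SIGMA i:{1..a}. {1..\<nu> i})"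
    by auto
  then show "finite (arcs (car a \<nu>))" by (simp add: car_def)
qed (auto simp: car_def)

lemma card_arcs_car: "card (arcs (car a \<nu>)) = 2 * a + (\<Sum>i=1..a. \<nu> i) + 2"
proof -
  let ?I = "(\<lambda>(i, k). Init i k) ` (SIGMA i:{1..a}. {1..\<nu> i})"
  have arcs: "arcs (car a \<nu>) = ?I \<union> (Final ` {2..a + 1} \<union> Path ` {1..a + 2})"
    by (auto simp: car_def)
  have I: "card ?I = (\<Sum>i=1..a. \<nu> i)"
    by (subst card_image) (auto simp: inj_on_def)
  have FP: "card (Final ` {2..a + 1} \<union> Path ` {1..a + 2}) = a + (a + 2)"
    by (subst card_Un_disjoint) (auto simp: card_image inj_on_def)
  have "card (?I \<union> (Final ` {2..a + 1} \<union> Path ` {1..a + 2})) = (\<Sum>i=1..a. \<nu> i) + (a + (a + 2))"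
    by (subst card_Un_disjoint) (simp_all only: I FP, auto)
  then show ?thesis unfolding arcs by simp
qed

section \<open>Flow polytopes\<close>

text \<open>
  The ambient space is $\mathbb{R}^m$ with its coordinates indexed by the edges of \<open>G\<close>: the
  finite index type \<open>'e\<close> is identified with the edge set by a bijection \<open>\<epsilon>\<close>.
  The vertices of \<open>G\<close> are \<open>1, \<dots>, n + 1\<close>.
\<close>

definition flow_polytope ::
    "nat \<Rightarrow> (nat, 'b) pre_digraph \<Rightarrow> ('e::finite \<Rightarrow> 'b) \<Rightarrow> (real ^ 'e) set" where
  "flow_polytope n G \<epsilon> = {x.
     (\<forall>e. 0 \<le> x $ e) \<and>
     (\<Sum>e\<in>\<epsilon> -` out_arcs G 1. x $ e) = 1 \<and>
     (\<forall>j\<in>{2..n}. (\<Sum>e\<in>\<epsilon> -` out_arcs G j. x $ e) = (\<Sum>e\<in>\<epsilon> -` in_arcs G j. x $ e))}"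

section \<open>Ehrhart series and $h^*$-polynomials\<close>

definition ehrhart :: "(real ^ 'e::finite) set \<Rightarrow> nat \<Rightarrow> nat" where
  "ehrhart P t = card {x \<in> (\<lambda>x. real t *\<^sub>R x) ` P. \<forall>e. x $ e \<in> \<int>}"

definition is_hstar_poly :: "(real ^ 'e::finite) set \<Rightarrow> real poly \<Rightarrow> bool" where
  "is_hstar_poly P h \<longleftrightarrow>
     Abs_fps (\<lambda>t. real (ehrhart P t)) = fps_of_poly h / (1 - fps_X) ^ (nat (aff_dim P) + 1)"

lemma is_hstar_poly_unique:
  assumes "is_hstar_poly P h" "is_hstar_poly P h'"
  shows "h = h'"
proof -
  define D :: "real fps" where "D = (1 - fps_X) ^ (nat (aff_dim P) + 1)"
  have D: "fps_nth D 0 \<noteq> 0" by (simp add: D_def fps_power_zeroth)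
  then have "D \<noteq> 0" by auto
  have "fps_of_poly h / D = fps_of_poly h' / D"
    using assms by (simp add: is_hstar_poly_def D_def)
  then have "fps_of_poly h * inverse D = fps_of_poly h' * inverse D"
    using D by (simp add: fps_divide_unit)
  moreover have "inverse D \<noteq> 0" using D by simp
  ultimately show ?thesis by simp
qed

end

theory Submission
  imports Defs
begin

text \<open>
  Put \<open>B j = \<nu> 1 + \<dots> + \<nu> j\<close>.  Read along the path \<open>1, 2, \<dots>, a + 3\<close>, an integral flow of
  size \<open>t\<close> is recorded by two weakly increasing sequences: \<open>F\<^sub>j\<close> (\<open>1 \<le> j \<le> a\<close>), the amount that
  the first \<open>j\<close> edges into the sink have carried away, and \<open>U\<^sub>l\<close> (\<open>0 \<le> l < b\<close>), the amount that the
  edge \<open>(1, 2)\<close> together with the first \<open>l\<close> edges \<open>(1, i + 2)\<close> have brought in; all of them would bring in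
  \<open>U\<^sub>b = t\<close>.  The flow on the path edge that leaves a vertex is the amount brought in so far minus
  the amount carried away so far, so nonnegativity of these edges says \<open>F\<^sub>j \<le> U\<^bsub>B (j - 1)\<^esub>\<close>.
  Hence the flow polytope is an order polytope: that of two disjoint chains with \<open>a\<close> and \<open>b\<close>
  elements, linked by these inequalities.

  A linear extension of this poset merges the two chains.  Writing a north step for an \<open>F\<close> and an
  east step for a \<open>U\<close>, the links say that at most \<open>B (j - 1)\<close> east steps precede the \<open>j\<close>-th north
  step, so the linear extensions are exactly the \<open>\<nu>\<close>-Dyck paths.  Sorting the entries of a lattice
  point by value, with north before east among equal values, attaches to it one such path \<open>p\<close>, and
  the lattice points attached to \<open>p\<close> are the sequences
  \<open>0 \<le> z\<^sub>1 \<le> \<dots> \<le> z\<^bsub>a+b\<^esub> \<le> t\<close> whose inequality is strict wherever \<open>p\<close> has a valley.  Their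
  generating function in \<open>t\<close> is \<open>x\<^sup>v / (1 - x)\<^bsup>a+b+1\<^esup>\<close> for \<open>v\<close> valleys, and summing over \<open>p\<close> gives the
  theorem, because the polytope has dimension \<open>a + b\<close>.

  These steps are \<open>labellings_fps\<close> (one path), \<open>bij_betw_split_parity\<close> (sorting),
  \<open>ehrhart_flow_polytope\<close> (lattice points) and \<open>aff_dim_flow_polytope\<close> (dimension).
\<close>

section \<open>Sorted lists with a prescribed parity pattern\<close>

text \<open>
  A labelled step is coded by one number: a north step with value \<open>v\<close> by \<open>2 * v\<close> and an east step with
  value \<open>v\<close> by \<open>2 * v + 1\<close>.  The usual order of the codes is then the order by value in which north
  comes before east among equal values, and sorted lists of codes are the merged sequences.
  Values at most \<open>t\<close> correspond to codes below \<open>2 * t + 2\<close>.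
\<close>

definition step_of :: "nat \<Rightarrow> step" where
  "step_of z = (if even z then North else East)"

definition labellings :: "nat \<Rightarrow> lattice_path \<Rightarrow> nat list set" where
  "labellings m p = {zs. sorted zs \<and> (\<forall>z\<in>set zs. z < m) \<and> map step_of zs = p}"

lemma finite_labellings: "finite (labellings m p)"
proof (rule finite_subset)
  show "labellings m p \<subseteq> {zs. set zs \<subseteq> {..<m} \<and> length zs = length p}"
    by (auto simp: labellings_def)
  show "finite {zs. set zs \<subseteq> {..<m} \<and> length zs = length p}"
    by (rule finite_lists_length_eq) simp
qed

lemma card_labellings_Nil: "card (labellings m []) = 1"
proof -
  have "labellings m [] = {[]}" by (auto simp: labellings_def)
  then show ?thesis by simp
qed

lemma card_labellings_0: "card (labellings 0 (p @ [s])) = 0"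
proof -
  have "labellings 0 (p @ [s]) = {}"
    by (auto simp: labellings_def)
  then show ?thesis by simp
qed

text \<open>
  The last entry of a sorted list is its largest, so it is either below \<open>m\<close> or equal to \<open>m\<close>; in the
  second case the remaining list is unconstrained by it.
\<close>

lemma card_labellings_snoc:
  "card (labellings (Suc m) (p @ [s])) =
     card (labellings m (p @ [s])) + (if step_of m = s then card (labellings (Suc m) p) else 0)"
proof -
  let ?new = "if step_of m = s then (\<lambda>zs. zs @ [m]) ` labellings (Suc m) p else {}"
  have "labellings (Suc m) (p @ [s]) = labellings m (p @ [s]) \<union> ?new"
  proof (intro equalityI subsetI)
    fix zs assume zs: "zs \<in> labellings (Suc m) (p @ [s])"
    then have "map step_of zs = p @ [s]" by (simp add: labellings_def)
    then obtain ws z where wz: "zs = ws @ [z]" "map step_of ws = p" "step_of z = s"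
      by (cases zs rule: rev_cases) auto
    show "zs \<in> labellings m (p @ [s]) \<union> ?new"
    proof (cases "z = m")
      case True
      then show ?thesis using zs wz by (auto simp: labellings_def sorted_append)
    next
      case False
      then show ?thesis using zs wz by (fastforce simp: labellings_def sorted_append)
    qed
  qed (force simp: labellings_def sorted_append less_Suc_eq_le split: if_splits)+
  moreover have "labellings m (p @ [s]) \<inter> ?new = {}"
    by (auto simp: labellings_def)
  moreover have "card ?new = (if step_of m = s then card (labellings (Suc m) p) else 0)"
    by (auto simp: card_image inj_on_def)
  ultimately show ?thesis
    by (simp add: card_Un_disjoint finite_labellings)
qed

definition new_valleys :: "lattice_path \<Rightarrow> step \<Rightarrow> nat" where
  "new_valleys p s = (if p \<noteq> [] \<and> last p = East \<and> s = North then 1 else 0)"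

lemma finite_valleys: "finite (valleys p)"
  by (rule finite_subset[of _ "{..<length p}"]) (auto simp: valleys_def)

lemma card_valleys_snoc: "card (valleys (p @ [s])) = card (valleys p) + new_valleys p s"
proof -
  let ?new = "if p \<noteq> [] \<and> last p = East \<and> s = North then {length p - 1} else {}"
  have "valleys (p @ [s]) = valleys p \<union> ?new"
  proof (rule set_eqI)
    fix i
    consider "i + 1 < length p" | "i + 1 = length p" | "i + 1 > length p" by linarith
    then show "i \<in> valleys (p @ [s]) \<longleftrightarrow> i \<in> valleys p \<union> ?new"
    proof cases
      case 2
      then have "p \<noteq> []" "i = length p - 1" by auto
      with 2 show ?thesis by (auto simp: valleys_def nth_append last_conv_nth)
    qed (auto simp: valleys_def nth_append)
  qed
  moreover have "valleys p \<inter> ?new = {}" by (auto simp: valleys_def)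
  ultimately show ?thesis
    by (simp add: card_Un_disjoint finite_valleys new_valleys_def)
qed

text \<open>
  The code \<open>2 * t\<close> is the only one that the bounds \<open>2 * t\<close> and \<open>2 * t + 1\<close> treat differently, and
  \<open>2 * t + 1\<close> is the only one that \<open>2 * t + 1\<close> and \<open>2 * t + 2\<close> treat differently.  Both matter
  only as a last entry of the right parity.  This is where a valley costs one unit: before a north step
  of value \<open>t\<close>, an east step has value less than \<open>t\<close>, a north step has value at most \<open>t\<close>.
\<close>

lemma card_labellings_odd:
  "card (labellings (2 * t + 1) p) =
     (if p \<noteq> [] \<and> last p = East then card (labellings (2 * t) p) else card (labellings (2 * t + 2) p))"
proof (cases p rule: rev_cases)
  case Nil
  then show ?thesis by (simp add: card_labellings_Nil)
next
  case (snoc q s)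
  then show ?thesis
    using card_labellings_snoc[of "2 * t" q s] card_labellings_snoc[of "2 * t + 1" q s]
    by (cases s) (auto simp: step_of_def)
qed

text \<open>
  Multiplication by \<open>1 - x\<close> leaves the lists whose last value is exactly \<open>t\<close>.  Removing that last
  entry leaves a list for the shorter path with values at most \<open>t\<close>, or less than \<open>t\<close> if the
  last step closes a valley; so each step contributes a factor \<open>1 / (1 - x)\<close> and each valley a
  further factor \<open>x\<close>.
\<close>

lemma labellings_fps:
  "Abs_fps (\<lambda>t. of_nat (card (labellings (2 * t + 2) p))) * (1 - fps_X) ^ (length p + 1)
     = (fps_X ^ card (valleys p) :: real fps)"
proof (induction p rule: rev_induct)
  case Nil
  have "Abs_fps (\<lambda>t. of_nat (card (labellings (2 * t + 2) []))) = Abs_fps (\<lambda>_. 1 :: real)"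
    by (simp add: card_labellings_Nil)
  moreover have "Abs_fps (\<lambda>_. 1 :: real) * (1 - fps_X) = 1"
    by (rule fps_ext) (auto simp: fps_mult_fps_X_commute right_diff_distrib)
  ultimately show ?case by (simp add: valleys_def)
next
  case (snoc s p)
  let ?G = "\<lambda>p. Abs_fps (\<lambda>t. of_nat (card (labellings (2 * t + 2) p))) :: real fps"
  have "?G (p @ [s]) * (1 - fps_X) = ?G p * fps_X ^ new_valleys p s"
  proof (rule fps_ext)
    fix t
    have odd: "card (labellings (2 * t + 2) (p @ [s])) = card (labellings (2 * t) (p @ [s]))
        + (if s = North then card (labellings (2 * t + 1) p) else card (labellings (2 * t + 2) p))"
      using card_labellings_snoc[of "2 * t" p s] card_labellings_snoc[of "2 * t + 1" p s]
      by (cases s) (auto simp: step_of_def)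
    show "fps_nth (?G (p @ [s]) * (1 - fps_X)) t = fps_nth (?G p * fps_X ^ new_valleys p s) t"
    proof (cases t)
      case 0
      have "card (labellings 0 p) = 0" if "p \<noteq> []"
        using that card_labellings_0 by (metis rev_exhaust)
      then show ?thesis
        using odd 0 card_labellings_0[of p s] card_labellings_odd[of 0 p]
        by (cases s) (auto simp: right_diff_distrib new_valleys_def numeral_2_eq_2)
    next
      case (Suc t')
      then show ?thesis
        using odd card_labellings_odd[of t p]
        by (cases s) (auto simp: right_diff_distrib new_valleys_def)
    qed
  qed
  then have "?G (p @ [s]) * (1 - fps_X) ^ (length (p @ [s]) + 1)
      = ?G p * fps_X ^ new_valleys p s * (1 - fps_X) ^ (length p + 1)"
    by (simp add: mult.assoc[symmetric])
  also have "\<dots> = fps_X ^ card (valleys p) * fps_X ^ new_valleys p s"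
    using snoc.IH by (simp add: ac_simps)
  finally show ?case by (simp add: card_valleys_snoc power_add)
qed

section \<open>Paths above \<open>\<nu>\<close>\<close>

abbreviation east_steps :: "(nat \<Rightarrow> nat) \<Rightarrow> nat \<Rightarrow> nat" where
  "east_steps \<nu> j \<equiv> \<Sum>i=1..j. \<nu> i"

lemma east_steps_mono: "i \<le> j \<Longrightarrow> east_steps \<nu> i \<le> east_steps \<nu> j"
  by (rule sum_mono2) auto

lemma nu_path_Suc: "nu_path (Suc a) \<nu> = nu_path a \<nu> @ North # replicate (\<nu> (Suc a)) East"
  by (simp add: nu_path_def)

lemma count_list_replicate: "count_list (replicate k x) y = (if x = y then k else 0)"
  by (induction k) auto

lemma endpoint_nu_path: "endpoint (nu_path a \<nu>) = (east_steps \<nu> a, a)"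
proof (induction a)
  case 0
  then show ?case by (simp add: nu_path_def endpoint_def)
next
  case (Suc a)
  then show ?case
    by (simp add: nu_path_Suc endpoint_def count_list_append count_list_replicate)
qed

lemma lattice_points_append:
  "lattice_points (p @ q) = lattice_points p \<union> (+) (endpoint p) ` lattice_points q"
proof (intro equalityI subsetI)
  fix v assume "v \<in> lattice_points (p @ q)"
  then obtain k where k: "k \<le> length p + length q" "v = endpoint (take k (p @ q))"
    by (auto simp: lattice_points_def)
  show "v \<in> lattice_points p \<union> (+) (endpoint p) ` lattice_points q"
  proof (cases "k \<le> length p")
    case True
    then show ?thesis using k by (auto simp: lattice_points_def)
  next
    case False
    then have "v = endpoint p + endpoint (take (k - length p) q)"
      using k by (simp add: endpoint_def count_list_append)
    moreover have "k - length p \<le> length q" using k by simp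
    ultimately show ?thesis by (auto simp: lattice_points_def)
  qed
next
  fix v assume "v \<in> lattice_points p \<union> (+) (endpoint p) ` lattice_points q"
  then show "v \<in> lattice_points (p @ q)"
  proof
    assume "v \<in> lattice_points p"
    then obtain k where "k \<le> length p" "v = endpoint (take k p)"
      by (auto simp: lattice_points_def)
    then have "k \<le> length (p @ q)" "v = endpoint (take k (p @ q))" by auto
    then show ?thesis unfolding lattice_points_def by blast
  next
    assume "v \<in> (+) (endpoint p) ` lattice_points q"
    then obtain k where "k \<le> length q" "v = endpoint p + endpoint (take k q)"
      by (auto simp: lattice_points_def)
    then have "length p + k \<le> length (p @ q)" "v = endpoint (take (length p + k) (p @ q))"
      by (auto simp: endpoint_def count_list_append)
    then show ?thesis unfolding lattice_points_def by blast
  qed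
qed

text \<open>
  One north step followed by east steps is the block from which \<open>\<nu>\<close> is built.
\<close>

lemma lattice_points_column:
  "lattice_points (North # replicate k East) = insert (0, 0) ((\<lambda>x. (x, 1)) ` {..k})"
proof (intro equalityI subsetI)
  fix v assume "v \<in> lattice_points (North # replicate k East)"
  then obtain l where "l \<le> Suc k" "v = endpoint (take l (North # replicate k East))"
    by (auto simp: lattice_points_def)
  then show "v \<in> insert (0, 0) ((\<lambda>x. (x, 1)) ` {..k})"
    by (cases l) (auto simp: endpoint_def count_list_replicate)
next
  fix v :: "nat \<times> nat" assume "v \<in> insert (0, 0) ((\<lambda>x. (x, 1)) ` {..k})"
  then consider "v = (0, 0)" | x where "x \<le> k" "v = (x, 1)" by auto
  then show "v \<in> lattice_points (North # replicate k East)"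
  proof cases
    case 1
    then have "0 \<le> length (North # replicate k East)"
      "v = endpoint (take 0 (North # replicate k East))"
      by (auto simp: endpoint_def)
    then show ?thesis unfolding lattice_points_def by blast
  next
    case 2
    then have "Suc x \<le> length (North # replicate k East)"
      "v = endpoint (take (Suc x) (North # replicate k East))"
      by (auto simp: endpoint_def count_list_replicate)
    then show ?thesis unfolding lattice_points_def by blast
  qed
qed

lemma lattice_points_nu_path:
  "(x, y) \<in> lattice_points (nu_path a \<nu>) \<longleftrightarrow>
     y \<le> a \<and> (if y = 0 then x = 0 else east_steps \<nu> (y - 1) \<le> x \<and> x \<le> east_steps \<nu> y)"
proof (induction a arbitrary: x y)
  case 0
  then show ?case by (auto simp: nu_path_def lattice_points_def endpoint_def)
next
  case (Suc a)
  have "(x, y) \<in> lattice_points (nu_path (Suc a) \<nu>) \<longleftrightarrow>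
      (x, y) \<in> lattice_points (nu_path a \<nu>) \<or> (x, y) = (east_steps \<nu> a, a) \<or>
      (\<exists>k\<le>\<nu> (Suc a). (x, y) = (east_steps \<nu> a + k, Suc a))"
    by (auto simp: nu_path_Suc lattice_points_append lattice_points_column endpoint_nu_path image_image image_iff)
  also have "(x, y) = (east_steps \<nu> a, a) \<Longrightarrow> (x, y) \<in> lattice_points (nu_path a \<nu>)"
    using east_steps_mono[of "a - 1" a \<nu>] by (auto simp: Suc.IH)
  then have "((x, y) \<in> lattice_points (nu_path a \<nu>) \<or> (x, y) = (east_steps \<nu> a, a) \<or>
      (\<exists>k\<le>\<nu> (Suc a). (x, y) = (east_steps \<nu> a + k, Suc a))) \<longleftrightarrow>
      (x, y) \<in> lattice_points (nu_path a \<nu>) \<or>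
      (\<exists>k\<le>\<nu> (Suc a). (x, y) = (east_steps \<nu> a + k, Suc a))"
    by blast
  also have "(\<exists>k\<le>\<nu> (Suc a). (x, y) = (east_steps \<nu> a + k, Suc a)) \<longleftrightarrow>
      y = Suc a \<and> east_steps \<nu> a \<le> x \<and> x \<le> east_steps \<nu> (Suc a)"
    by (auto simp: le_iff_add)
  finally show ?case by (auto simp: Suc.IH le_Suc_eq)
qed

text \<open>
  In column \<open>x\<close> the lowest point of \<open>\<nu>\<close> has as height the least \<open>y'\<close> with \<open>x \<le> B y'\<close>.
\<close>

lemma above_nu_path_iff:
  assumes "y \<le> a"
  shows "(\<exists>y'\<le>y. (x, y') \<in> lattice_points (nu_path a \<nu>)) \<longleftrightarrow> x \<le> east_steps \<nu> y"
proof
  assume "\<exists>y'\<le>y. (x, y') \<in> lattice_points (nu_path a \<nu>)"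
  then obtain y' where "y' \<le> y" "x \<le> east_steps \<nu> y'"
    by (auto simp: lattice_points_nu_path split: if_splits)
  then show "x \<le> east_steps \<nu> y" using east_steps_mono le_trans by blast
next
  assume x: "x \<le> east_steps \<nu> y"
  define y' where "y' = (LEAST y'. x \<le> east_steps \<nu> y')"
  have "y' \<le> y" "x \<le> east_steps \<nu> y'"
    unfolding y'_def using x by (auto intro: Least_le LeastI)
  moreover have "east_steps \<nu> (y' - 1) \<le> x" if "y' \<noteq> 0"
    using that not_less_Least[of "y' - 1" "\<lambda>y'. x \<le> east_steps \<nu> y'"]
    unfolding y'_def[symmetric] by simp
  ultimately show "\<exists>y'\<le>y. (x, y') \<in> lattice_points (nu_path a \<nu>)"
    using assms by (auto simp: lattice_points_nu_path intro!: exI[of _ y'])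
qed

lemma count_list_take_le: "count_list (take k p) s \<le> count_list p s"
  by (metis append_take_drop_id count_list_append le_add1)

lemma dyck_paths_nu_path_iff:
  "p \<in> dyck_paths (nu_path a \<nu>) \<longleftrightarrow>
     count_list p East = east_steps \<nu> a \<and> count_list p North = a \<and>
     (\<forall>k\<le>length p. count_list (take k p) East \<le> east_steps \<nu> (count_list (take k p) North))"
proof -
  have "weakly_above p (nu_path a \<nu>) \<longleftrightarrow>
      (\<forall>k\<le>length p. count_list (take k p) East \<le> east_steps \<nu> (count_list (take k p) North))"
    if "count_list p North = a"
  proof -
    have "weakly_above p (nu_path a \<nu>) \<longleftrightarrow>
        (\<forall>k\<le>length p. \<exists>y'\<le>count_list (take k p) North.
           (count_list (take k p) East, y') \<in> lattice_points (nu_path a \<nu>))"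
      unfolding weakly_above_def lattice_points_def[of p] by (fastforce simp: endpoint_def)
    also have "\<dots> \<longleftrightarrow> (\<forall>k\<le>length p.
        count_list (take k p) East \<le> east_steps \<nu> (count_list (take k p) North))"
      using above_nu_path_iff count_list_take_le[of _ p North] that by simp
    finally show ?thesis .
  qed
  then show ?thesis
    by (auto simp: dyck_paths_def endpoint_nu_path endpoint_def[of p])
qed

text \<open>
  The left side is the condition on the prefixes of a path, the right side the one on two chains.  In
  a sorted list, the odd entries that stand before an even entry \<open>f\<close> are the odd entries less than \<open>f\<close>,
  and the bound on a prefix is tightest just before an even entry and at the end of the list.  The
  offsets \<open>e\<close> and \<open>n\<close> count the entries already passed, for the induction.
\<close>

lemma sorted_prefix_counts_iff:
  fixes zs :: "nat list" and B :: "nat \<Rightarrow> nat"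
  assumes "sorted zs"
  shows "(\<forall>k\<le>length zs. e + length (filter odd (take k zs)) \<le> B (n + length (filter even (take k zs))))
    \<longleftrightarrow> (\<forall>j<length (filter even zs). e + length (filter (\<lambda>u. u < filter even zs ! j) (filter odd zs)) \<le> B (n + j))
        \<and> e + length (filter odd zs) \<le> B (n + length (filter even zs))"
  using assms
proof (induction zs arbitrary: e n)
  case Nil
  then show ?case by simp
next
  case (Cons z zs)
  have split: "(\<forall>k\<le>length (z # zs). P k) \<longleftrightarrow> P 0 \<and> (\<forall>k\<le>length zs. P (Suc k))" for P
    by (simp add: less_Suc_eq_le[symmetric] All_less_Suc2)
  have sorted: "sorted zs" "\<forall>y\<in>set zs. z \<le> y" using Cons.prems by auto
  show ?case
  proof (cases "even z")
    case True
    have "filter (\<lambda>u. u < z) (filter odd zs) = []" using sorted by (auto simp: filter_empty_conv)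
    then show ?thesis
      unfolding split using True Cons.IH[OF sorted(1), of e "Suc n"]
      by (auto simp: All_less_Suc2)
  next
    case False
    \<comment> \<open>A leading odd entry lies below every even entry, so it adds one to every count.\<close>
    have "z < filter even zs ! j" if "j < length (filter even zs)" for j
    proof -
      have "filter even zs ! j \<in> set (filter even zs)" using that by (rule nth_mem)
      then have "even (filter even zs ! j)" "z \<le> filter even zs ! j" using sorted by auto
      then show ?thesis using False by (metis le_neq_implies_less)
    qed
    moreover have "e \<le> B n" if "Suc e \<le> B n" using that by simp
    ultimately show ?thesis
      unfolding split using False Cons.IH[OF sorted(1), of "Suc e" n]
      by (auto dest: spec[of _ 0])
  qed
qed

lemma sorted_count_less_le_iff:
  fixes us :: "'a::linorder list"
  assumes "sorted us"
  shows "length (filter (\<lambda>u. u < f) us) \<le> k \<longleftrightarrow> (k < length us \<longrightarrow> f \<le> us ! k)"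
  using assms
proof (induction us arbitrary: k)
  case Nil
  then show ?case by simp
next
  case (Cons u us)
  show ?case
  proof (cases "u < f")
    case True
    then show ?thesis using Cons by (cases k) auto
  next
    case False
    then have "filter (\<lambda>u. u < f) us = []" using Cons.prems by (force simp: filter_empty_conv)
    moreover have "f \<le> (u # us) ! k" if "k < length (u # us)"
    proof -
      have "u \<le> (u # us) ! k" using Cons.prems that by (cases k) auto
      then show ?thesis using False by simp
    qed
    ultimately show ?thesis using False by simp
  qed
qed

section \<open>Pairs of interlaced chains\<close>

text \<open>
  The lattice points of the \<open>t\<close>-fold order polytope.  Appending \<open>t\<close> to \<open>U\<close> supplies the top value
  \<open>U\<^sub>b = t\<close>, to which the condition refers when \<open>east_steps \<nu> j\<close> equals the length of \<open>U\<close>.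
  Positions in \<open>F\<close> start at 0, so \<open>F ! j\<close> belongs to the \<open>(j + 1)\<close>-st north step.
\<close>

definition chain_pairs :: "nat \<Rightarrow> (nat \<Rightarrow> nat) \<Rightarrow> nat \<Rightarrow> (nat list \<times> nat list) set" where
  "chain_pairs a \<nu> t = {(F, U).
     length F = a \<and> length U = east_steps \<nu> a \<and> sorted F \<and> sorted U \<and>
     (\<forall>f\<in>set F. f \<le> t) \<and> (\<forall>u\<in>set U. u \<le> t) \<and>
     (\<forall>j<a. F ! j \<le> (U @ [t]) ! east_steps \<nu> j)}"

definition split_parity :: "nat list \<Rightarrow> nat list \<times> nat list" where
  "split_parity zs = (map (\<lambda>z. z div 2) (filter even zs), map (\<lambda>z. z div 2) (filter odd zs))"

definition merge_parity :: "nat list \<times> nat list \<Rightarrow> nat list" where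
  "merge_parity = (\<lambda>(F, U). sort (map (\<lambda>f. 2 * f) F @ map (\<lambda>u. 2 * u + 1) U))"

text \<open>
  Since \<open>filter\<close> commutes with \<open>sort\<close>, filtering by parity recovers the two sorted chains.
\<close>

lemma split_merge_parity:
  assumes "sorted F" "sorted U"
  shows "split_parity (merge_parity (F, U)) = (F, U)"
proof -
  have "filter even (map (\<lambda>f. 2 * f) F @ map (\<lambda>u. 2 * u + 1) U) = map (\<lambda>f. 2 * f) F"
    "filter odd (map (\<lambda>f. 2 * f) F @ map (\<lambda>u. 2 * u + 1) U) = map (\<lambda>u. 2 * u + 1) U"
    by (auto simp: filter_map o_def)
  moreover have "sorted (map (\<lambda>f. 2 * f) F)" "sorted (map (\<lambda>u. 2 * u + 1) U)"
    using assms by (simp_all add: sorted_map)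
  ultimately have "filter even (merge_parity (F, U)) = map (\<lambda>f. 2 * f) F"
    "filter odd (merge_parity (F, U)) = map (\<lambda>u. 2 * u + 1) U"
    by (simp_all only: merge_parity_def prod.case filter_sort sorted_sort_id)
  then show ?thesis
    by (simp only: split_parity_def) (simp add: o_def)
qed

lemma merge_split_parity:
  assumes "sorted zs"
  shows "merge_parity (split_parity zs) = zs"
proof -
  have "map (\<lambda>f. 2 * f) (map (\<lambda>z. z div 2) (filter even zs)) = filter even zs"
    "map (\<lambda>u. 2 * u + 1) (map (\<lambda>z. z div 2) (filter odd zs)) = filter odd zs"
    by (auto intro!: map_idI)
  then have "merge_parity (split_parity zs) = sort (filter even zs @ filter odd zs)"
    by (simp add: merge_parity_def split_parity_def del: map_map)
  also have "\<dots> = zs"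
    by (rule properties_for_sort) (use assms in \<open>simp_all\<close>)
  finally show ?thesis .
qed

lemma count_list_step_of:
  "count_list (map step_of zs) East = length (filter odd zs)"
  "count_list (map step_of zs) North = length (filter even zs)"
  by (induction zs) (auto simp: step_of_def)

lemma even_le_odd_iff: "even x \<Longrightarrow> odd y \<Longrightarrow> x \<le> y \<longleftrightarrow> x div 2 \<le> y div 2" for x y :: nat
  by (elim evenE oddE) presburger

text \<open>
  The number of odd entries less than \<open>f\<close> is at most \<open>B j\<close> iff the odd entry at position \<open>B j\<close>, if
  there is one, is at least \<open>f\<close>.  If there is none, the chain condition compares with \<open>t\<close> and holds as
  well.
\<close>

lemma dyck_path_iff_chain_pair:
  assumes sorted: "sorted zs" and bound: "\<And>z. z \<in> set zs \<Longrightarrow> z < 2 * t + 2"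
  shows "map step_of zs \<in> dyck_paths (nu_path a \<nu>) \<longleftrightarrow> split_parity zs \<in> chain_pairs a \<nu> t"
proof -
  let ?E = "filter even zs" and ?O = "filter odd zs"
  let ?B = "east_steps \<nu>"
  have dyck: "map step_of zs \<in> dyck_paths (nu_path a \<nu>) \<longleftrightarrow>
      length ?O = ?B a \<and> length ?E = a \<and>
      (\<forall>j<length ?E. length (filter (\<lambda>u. u < ?E ! j) ?O) \<le> ?B j)"
    using sorted_prefix_counts_iff[OF sorted, of 0 ?B 0]
    by (auto simp: dyck_paths_nu_path_iff take_map count_list_step_of)
  have halves: "z div 2 \<le> t" if "z \<in> set zs" for z
    using bound[OF that] by simp
  have sortedEO: "sorted ?E" "sorted ?O"
    using sorted by (simp_all add: sorted_wrt_filter)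
  have mono: "sorted (map (\<lambda>z. z div 2) xs)" if "sorted xs" for xs :: "nat list"
    using that by (auto simp: sorted_iff_nth_mono intro: div_le_mono)
  have compare: "length (filter (\<lambda>u. u < ?E ! j) ?O) \<le> ?B j \<longleftrightarrow>
      ?E ! j div 2 \<le> (map (\<lambda>z. z div 2) ?O @ [t]) ! ?B j"
    if "length ?O = ?B a" "length ?E = a" "j < a" for j
  proof -
    have j: "?E ! j \<in> set ?E" using that by (intro nth_mem) simp
    have le: "?B j \<le> ?B a" using that east_steps_mono by simp
    show ?thesis
    proof (cases "?B j < ?B a")
      case True
      then have "?O ! ?B j \<in> set ?O" using that by (intro nth_mem) simp
      then have "?E ! j \<le> ?O ! ?B j \<longleftrightarrow> ?E ! j div 2 \<le> ?O ! ?B j div 2"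
        using j by (intro even_le_odd_iff) auto
      then show ?thesis
        using True that sorted_count_less_le_iff[OF sortedEO(2), of "?E ! j" "?B j"]
        by (simp add: nth_append)
    next
      case False
      then have "?B j = length ?O" using le that by simp
      moreover have "(map (\<lambda>z. z div 2) ?O @ [t]) ! length ?O = t"
        by (metis length_map nth_append_length)
      moreover have "length (filter (\<lambda>u. u < ?E ! j) ?O) \<le> length ?O"
        by (rule length_filter_le)
      ultimately show ?thesis
        using j halves by (simp del: filter_filter)
    qed
  qed
  have "split_parity zs \<in> chain_pairs a \<nu> t \<longleftrightarrow> length ?O = ?B a \<and> length ?E = a \<and>
      (\<forall>j<a. ?E ! j div 2 \<le> (map (\<lambda>z. z div 2) ?O @ [t]) ! ?B j)"
    using halves mono[OF sortedEO(1)] mono[OF sortedEO(2)]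
    by (auto simp: chain_pairs_def split_parity_def)
  then show ?thesis
    unfolding dyck using compare by blast
qed

lemma bij_betw_split_parity:
  "bij_betw split_parity (\<Union>p\<in>dyck_paths (nu_path a \<nu>). labellings (2 * t + 2) p) (chain_pairs a \<nu> t)"
proof (rule bij_betw_byWitness[where f' = merge_parity])
  let ?A = "\<Union>p\<in>dyck_paths (nu_path a \<nu>). labellings (2 * t + 2) p"
  have A: "zs \<in> ?A \<longleftrightarrow> sorted zs \<and> (\<forall>z\<in>set zs. z < 2 * t + 2) \<and> split_parity zs \<in> chain_pairs a \<nu> t" for zs
    using dyck_path_iff_chain_pair[of zs t a \<nu>] by (auto simp: labellings_def)
  show "\<forall>zs\<in>?A. merge_parity (split_parity zs) = zs"
    using A merge_split_parity by blast
  show *: "\<forall>c\<in>chain_pairs a \<nu> t. split_parity (merge_parity c) = c"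
    using split_merge_parity by (auto simp: chain_pairs_def)
  show "split_parity ` ?A \<subseteq> chain_pairs a \<nu> t" using A by blast
  show "merge_parity ` chain_pairs a \<nu> t \<subseteq> ?A"
  proof
    fix zs assume "zs \<in> merge_parity ` chain_pairs a \<nu> t"
    then obtain c where c: "c \<in> chain_pairs a \<nu> t" "zs = merge_parity c" by blast
    then have "sorted zs" "\<forall>z\<in>set zs. z < 2 * t + 2"
      by (auto simp: merge_parity_def chain_pairs_def split: prod.splits)
    moreover have "split_parity zs \<in> chain_pairs a \<nu> t" using c * by simp
    ultimately show "zs \<in> ?A" using A by blast
  qed
qed

lemma card_chain_pairs:
  "card (chain_pairs a \<nu> t) = (\<Sum>p\<in>dyck_paths (nu_path a \<nu>). card (labellings (2 * t + 2) p))"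
proof -
  have "card (chain_pairs a \<nu> t) = card (\<Union>p\<in>dyck_paths (nu_path a \<nu>). labellings (2 * t + 2) p)"
    using bij_betw_same_card[OF bij_betw_split_parity] by simp
  also have "\<dots> = (\<Sum>p\<in>dyck_paths (nu_path a \<nu>). card (labellings (2 * t + 2) p))"
    by (rule card_UN_disjoint) (auto simp: finite_dyck_paths finite_labellings, auto simp: labellings_def)
  finally show ?thesis .
qed

lemma fps_of_narayana_poly:
  "fps_of_poly (narayana_poly \<mu>) = (\<Sum>p\<in>dyck_paths \<mu>. fps_X ^ card (valleys p))"
proof (rule fps_ext)
  fix i
  have "fps_nth (\<Sum>p\<in>dyck_paths \<mu>. fps_X ^ card (valleys p)) i =
      (\<Sum>p\<in>dyck_paths \<mu>. if card (valleys p) = i then 1 else (0 :: real))"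
    by (auto simp: fps_sum_nth intro!: sum.cong)
  also have "\<dots> = real (card {p \<in> dyck_paths \<mu>. card (valleys p) = i})"
    by (simp add: sum.If_cases finite_dyck_paths Int_def)
  finally show "fps_nth (fps_of_poly (narayana_poly \<mu>)) i =
      fps_nth (\<Sum>p\<in>dyck_paths \<mu>. fps_X ^ card (valleys p)) i"
    by (simp add: coeff_narayana_poly narayana_def)
qed

lemma chain_pairs_fps:
  "Abs_fps (\<lambda>t. real (card (chain_pairs a \<nu> t))) * (1 - fps_X) ^ (a + east_steps \<nu> a + 1)
     = fps_of_poly (narayana_poly (nu_path a \<nu>))"
proof -
  let ?D = "dyck_paths (nu_path a \<nu>)"
  let ?G = "\<lambda>p. Abs_fps (\<lambda>t. of_nat (card (labellings (2 * t + 2) p))) :: real fps"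
  have "Abs_fps (\<lambda>t. real (card (chain_pairs a \<nu> t))) = (\<Sum>p\<in>?D. ?G p)"
    by (rule fps_ext) (simp add: card_chain_pairs fps_sum_nth)
  then have "Abs_fps (\<lambda>t. real (card (chain_pairs a \<nu> t))) * (1 - fps_X) ^ (a + east_steps \<nu> a + 1)
      = (\<Sum>p\<in>?D. ?G p * (1 - fps_X) ^ (a + east_steps \<nu> a + 1))"
    by (simp add: sum_distrib_right)
  also have "\<dots> = (\<Sum>p\<in>?D. fps_X ^ card (valleys p))"
  proof (rule sum.cong)
    fix p assume "p \<in> ?D"
    then have "length p = a + east_steps \<nu> a"
      by (simp add: length_eq_counts dyck_paths_nu_path_iff)
    then show "?G p * (1 - fps_X) ^ (a + east_steps \<nu> a + 1) = fps_X ^ card (valleys p)"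
      using labellings_fps[of p] by simp
  qed simp
  finally show ?thesis by (simp add: fps_of_narayana_poly)
qed

section \<open>Flows on the caracol graph as potential differences\<close>

text \<open>
  A potential \<open>Z\<close> lists the numbers \<open>0, F\<^sub>1, \<dots>, F\<^sub>a, U\<^sub>0, \<dots>, U\<^sub>b\<close> at the positions \<open>0\<close> to
  \<open>a + 1 + b\<close>, so \<open>F\<^sub>j\<close> is at \<open>j\<close> and \<open>U\<^sub>l\<close> at \<open>a + 1 + l\<close>.  In these terms the flow on every edge
  is a difference of two entries, at a top and a bottom position.  For the edges \<open>Path j\<close> the
  truncated subtraction \<open>j - 2\<close> covers \<open>j = 1\<close>, and \<open>min\<close> covers \<open>j = a + 2\<close>, a vertex without an
  edge \<open>Final j\<close>.
\<close>

fun top_index :: "nat \<Rightarrow> (nat \<Rightarrow> nat) \<Rightarrow> car_edge \<Rightarrow> nat" where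
  "top_index a \<nu> (Init i k) = a + 1 + east_steps \<nu> (i - 1) + k"
| "top_index a \<nu> (Final i) = i - 1"
| "top_index a \<nu> (Path j) = a + 1 + east_steps \<nu> (j - 2)"

fun bottom_index :: "nat \<Rightarrow> (nat \<Rightarrow> nat) \<Rightarrow> car_edge \<Rightarrow> nat" where
  "bottom_index a \<nu> (Init i k) = a + east_steps \<nu> (i - 1) + k"
| "bottom_index a \<nu> (Final i) = i - 2"
| "bottom_index a \<nu> (Path j) = min (j - 1) a"

definition potential_flow :: "nat \<Rightarrow> (nat \<Rightarrow> nat) \<Rightarrow> (nat \<Rightarrow> real) \<Rightarrow> car_edge \<Rightarrow> real" where
  "potential_flow a \<nu> Z \<alpha> = Z (top_index a \<nu> \<alpha>) - Z (bottom_index a \<nu> \<alpha>)"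

lemma ball_arcs_car:
  "(\<forall>\<alpha>\<in>arcs (car a \<nu>). Q \<alpha>) \<longleftrightarrow>
     (\<forall>i\<in>{1..a}. \<forall>k\<in>{1..\<nu> i}. Q (Init i k)) \<and> (\<forall>i\<in>{2..a + 1}. Q (Final i)) \<and>
     (\<forall>j\<in>{1..a + 2}. Q (Path j))"
  unfolding car_def by fastforce

lemma east_steps_Suc_pred: "1 \<le> i \<Longrightarrow> east_steps \<nu> (i - 1) + \<nu> i = east_steps \<nu> i"
  by (cases i) auto

lemma east_index_less: "k \<in> {1..\<nu> i} \<Longrightarrow> i \<in> {1..a} \<Longrightarrow> east_steps \<nu> (i - 1) + k \<le> east_steps \<nu> a"
  using east_steps_Suc_pred[of i \<nu>] east_steps_mono[of i a \<nu>] by auto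

text \<open>
  Together with \<open>east_index_inj\<close>: numbering the edges \<open>Init i k\<close> by \<open>east_steps \<nu> (i - 1) + k\<close> enumerates
  them as \<open>1, \<dots>, b\<close>.
\<close>

lemma east_index_surj:
  "1 \<le> l \<Longrightarrow> l \<le> east_steps \<nu> a \<Longrightarrow> \<exists>i\<in>{1..a}. \<exists>k\<in>{1..\<nu> i}. l = east_steps \<nu> (i - 1) + k"
proof (induction a)
  case 0
  then show ?case by simp
next
  case (Suc a)
  show ?case
  proof (cases "l \<le> east_steps \<nu> a")
    case True
    then show ?thesis using Suc by fastforce
  next
    case False
    then have "l - east_steps \<nu> a \<in> {1..\<nu> (Suc a)}" "l = east_steps \<nu> (Suc a - 1) + (l - east_steps \<nu> a)"
      using Suc.prems by auto
    then show ?thesis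
      by (intro bexI[where x = "Suc a"] bexI[where x = "l - east_steps \<nu> a"]) simp_all
  qed
qed

lemma east_index_inj:
  assumes "east_steps \<nu> (i - 1) + k = east_steps \<nu> (i' - 1) + k'"
    and "1 \<le> i" "1 \<le> i'" "k \<in> {1..\<nu> i}" "k' \<in> {1..\<nu> i'}"
  shows "i = i' \<and> k = k'"
proof -
  have less: "east_steps \<nu> (i - 1) + k < east_steps \<nu> (i' - 1) + k'"
    if "i < i'" "1 \<le> i" "k \<in> {1..\<nu> i}" "k' \<in> {1..\<nu> i'}" for i i' k k'
  proof -
    have "east_steps \<nu> i \<le> east_steps \<nu> (i' - 1)"
      using that by (intro east_steps_mono) simp
    then show ?thesis using that east_steps_Suc_pred[of i \<nu>] by simp
  qed
  have "i = i'"
    using less[of i i' k k'] less[of i' i k' k] assms by (cases i i' rule: linorder_cases) simp_all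
  with assms show ?thesis by simp
qed

text \<open>
  The edges \<open>Final\<close> give the successive differences along \<open>F\<close>, the edges \<open>Init\<close> those along
  \<open>U\<close>, and the edges \<open>Path\<close> the differences between the two chains.  Nonnegativity as
  \<open>Q\<close> gives the inequalities of the order polytope.
\<close>

lemma ball_potential_flow:
  "(\<forall>\<alpha>\<in>arcs (car a \<nu>). Q (potential_flow a \<nu> Z \<alpha>)) \<longleftrightarrow>
     (\<forall>i<a. Q (Z (Suc i) - Z i)) \<and>
     (\<forall>l<east_steps \<nu> a. Q (Z (a + 1 + Suc l) - Z (a + 1 + l))) \<and>
     (\<forall>j\<in>{1..a + 2}. Q (Z (a + 1 + east_steps \<nu> (j - 2)) - Z (min (j - 1) a)))"
proof -
  have "(\<forall>i\<in>{1..a}. \<forall>k\<in>{1..\<nu> i}. Q (potential_flow a \<nu> Z (Init i k))) \<longleftrightarrow>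
      (\<forall>l\<in>{1..east_steps \<nu> a}. Q (Z (a + 1 + l) - Z (a + l)))"
  proof (intro iffI ballI)
    fix l assume *: "\<forall>i\<in>{1..a}. \<forall>k\<in>{1..\<nu> i}. Q (potential_flow a \<nu> Z (Init i k))"
      and "l \<in> {1..east_steps \<nu> a}"
    then obtain i k where "i \<in> {1..a}" "k \<in> {1..\<nu> i}" "l = east_steps \<nu> (i - 1) + k"
      using east_index_surj[of l \<nu> a] by auto
    moreover from this * have "Q (potential_flow a \<nu> Z (Init i k))" by blast
    ultimately show "Q (Z (a + 1 + l) - Z (a + l))"
      by (simp add: potential_flow_def add.assoc)
  next
    fix i k assume *: "\<forall>l\<in>{1..east_steps \<nu> a}. Q (Z (a + 1 + l) - Z (a + l))"
      and ik: "i \<in> {1..a}" "k \<in> {1..\<nu> i}"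
    have "east_steps \<nu> (i - 1) + k \<in> {1..east_steps \<nu> a}"
      using ik east_index_less[of k \<nu> i a] by simp
    with * show "Q (potential_flow a \<nu> Z (Init i k))"
      by (auto simp: potential_flow_def add.assoc)
  qed
  also have "\<dots> \<longleftrightarrow> (\<forall>l<east_steps \<nu> a. Q (Z (a + 1 + Suc l) - Z (a + 1 + l)))"
  proof (intro iffI ballI allI impI)
    fix l assume *: "\<forall>l<east_steps \<nu> a. Q (Z (a + 1 + Suc l) - Z (a + 1 + l))"
      and "l \<in> {1..east_steps \<nu> a}"
    then show "Q (Z (a + 1 + l) - Z (a + l))" by (cases l) auto
  next
    fix l assume *: "\<forall>l\<in>{1..east_steps \<nu> a}. Q (Z (a + 1 + l) - Z (a + l))" and "l < east_steps \<nu> a"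
    then have "Suc l \<in> {1..east_steps \<nu> a}" by simp
    with * have "Q (Z (a + 1 + Suc l) - Z (a + Suc l))" by blast
    then show "Q (Z (a + 1 + Suc l) - Z (a + 1 + l))" by simp
  qed
  finally have Init: "(\<forall>i\<in>{1..a}. \<forall>k\<in>{1..\<nu> i}. Q (potential_flow a \<nu> Z (Init i k))) \<longleftrightarrow>
      (\<forall>l<east_steps \<nu> a. Q (Z (a + 1 + Suc l) - Z (a + 1 + l)))" .
  have "(\<forall>i\<in>{2..a + 1}. Q (potential_flow a \<nu> Z (Final i))) \<longleftrightarrow> (\<forall>i<a. Q (Z (Suc i) - Z i))"
  proof (intro iffI ballI allI impI)
    fix i assume "\<forall>i\<in>{2..a + 1}. Q (potential_flow a \<nu> Z (Final i))" "i < a"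
    then show "Q (Z (Suc i) - Z i)"
      by (auto simp: potential_flow_def dest: bspec[where x = "i + 2"])
  next
    fix i assume "\<forall>i<a. Q (Z (Suc i) - Z i)" "i \<in> {2..a + 1}"
    then show "Q (potential_flow a \<nu> Z (Final i))"
      by (auto simp: potential_flow_def Suc_diff_Suc numeral_2_eq_2 dest: spec[where x = "i - 2"])
  qed
  then show ?thesis
    unfolding ball_arcs_car Init by (simp add: potential_flow_def conj_ac)
qed

text \<open>
  Every position of \<open>Z\<close> is reached from position 0 by adding flows of edges: along \<open>Final\<close> edges to
  the entries of \<open>F\<close>, and by \<open>Path 1\<close> followed by \<open>Init\<close> edges to the entries of \<open>U\<close>.
\<close>

lemma potential_in_closed_set:
  assumes "Z 0 = 0" "0 \<in> A" "\<And>x y. x \<in> A \<Longrightarrow> y \<in> A \<Longrightarrow> x + y \<in> A"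
    and "\<forall>\<alpha>\<in>arcs (car a \<nu>). potential_flow a \<nu> Z \<alpha> \<in> A"
    and "m \<le> a + 1 + east_steps \<nu> a"
  shows "Z m \<in> A"
proof -
  have steps: "\<forall>i<a. Z (Suc i) - Z i \<in> A" "\<forall>l<east_steps \<nu> a. Z (a + 1 + Suc l) - Z (a + 1 + l) \<in> A"
    and cross: "\<forall>j\<in>{1..a + 2}. Z (a + 1 + east_steps \<nu> (j - 2)) - Z (min (j - 1) a) \<in> A"
    using assms(4) unfolding ball_potential_flow[where Q = "\<lambda>x. x \<in> A"] by blast+
  have step: "y \<in> A" if "x \<in> A" "y - x \<in> A" for x y
    using assms(3)[OF that] by simp
  have final: "i \<le> a \<Longrightarrow> Z i \<in> A" for i
  proof (induction i)
    case (Suc i)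
    then have "Z i \<in> A" "Z (Suc i) - Z i \<in> A" using steps(1) by simp_all
    then show ?case by (rule step)
  qed (use assms in simp)
  have "Z (a + 1) - Z 0 \<in> A" using cross by (auto dest: bspec[where x = 1])
  then have base: "Z (a + 1) \<in> A" using assms by simp
  have init: "l \<le> east_steps \<nu> a \<Longrightarrow> Z (a + 1 + l) \<in> A" for l
  proof (induction l)
    case (Suc l)
    then have "Z (a + 1 + l) \<in> A" "Z (a + 1 + Suc l) - Z (a + 1 + l) \<in> A"
      using steps(2) by simp_all
    then show ?case by (rule step)
  qed (use base in simp)
  show ?thesis
    using final[of m] init[of "m - (a + 1)"] assms(5) by (cases "m \<le> a") auto
qed

text \<open>
  The equations of the flow polytope, written out edge by edge and for an arbitrary total flow \<open>t\<close>.
\<close>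

definition conserves :: "nat \<Rightarrow> (nat \<Rightarrow> nat) \<Rightarrow> real \<Rightarrow> (car_edge \<Rightarrow> real) \<Rightarrow> bool" where
  "conserves a \<nu> t y \<longleftrightarrow>
     y (Path 1) + (\<Sum>i=1..a. \<Sum>k=1..\<nu> i. y (Init i k)) = t \<and>
     (\<forall>j\<in>{2..a + 2}. y (Path j) + (if j \<le> a + 1 then y (Final j) else 0) =
        y (Path (j - 1)) + (if 3 \<le> j then \<Sum>k=1..\<nu> (j - 2). y (Init (j - 2) k) else 0))"

lemma sum_potential_flow_Init:
  assumes "1 \<le> i"
  shows "(\<Sum>k=1..\<nu> i. potential_flow a \<nu> Z (Init i k)) =
    Z (a + 1 + east_steps \<nu> i) - Z (a + 1 + east_steps \<nu> (i - 1))"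
proof -
  let ?f = "\<lambda>k. Z (a + 1 + east_steps \<nu> (i - 1) + k)"
  have "(\<Sum>k=1..\<nu> i. potential_flow a \<nu> Z (Init i k)) = (\<Sum>k\<in>{Suc 0..\<nu> i}. ?f k - ?f (k - 1))"
    by (intro sum.cong) (auto simp: potential_flow_def intro!: arg_cong[where f = Z])
  also have "\<dots> = ?f (\<nu> i) - ?f 0" by (rule sum_telescope'') simp
  also have "\<dots> = Z (a + 1 + east_steps \<nu> i) - Z (a + 1 + east_steps \<nu> (i - 1))"
    using east_steps_Suc_pred[OF assms, of \<nu>] by (simp add: add.assoc)
  finally show ?thesis .
qed

text \<open>
  At each vertex the differences of potentials telescope.
\<close>

lemma conserves_potential_flow:
  assumes "1 \<le> a" "Z 0 = 0"
  shows "conserves a \<nu> (Z (a + 1 + east_steps \<nu> a)) (potential_flow a \<nu> Z)"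
  unfolding conserves_def
proof (intro conjI ballI)
  let ?f = "\<lambda>i. Z (a + 1 + east_steps \<nu> i)"
  have "(\<Sum>i=1..a. \<Sum>k=1..\<nu> i. potential_flow a \<nu> Z (Init i k)) = (\<Sum>i\<in>{Suc 0..a}. ?f i - ?f (i - 1))"
    by (intro sum.cong) (auto simp: sum_potential_flow_Init[unfolded One_nat_def])
  also have "\<dots> = ?f a - ?f 0" by (rule sum_telescope'') simp
  finally show "potential_flow a \<nu> Z (Path 1) + (\<Sum>i=1..a. \<Sum>k=1..\<nu> i. potential_flow a \<nu> Z (Init i k))
      = Z (a + 1 + east_steps \<nu> a)"
    using assms by (simp add: potential_flow_def)
next
  fix j assume "j \<in> {2..a + 2}"
  then have "j = (j - 2) + 2" "j - 2 \<le> a" by auto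
  then obtain i where i: "j = i + 2" "i \<le> a" by blast
  show "potential_flow a \<nu> Z (Path j) + (if j \<le> a + 1 then potential_flow a \<nu> Z (Final j) else 0) =
      potential_flow a \<nu> Z (Path (j - 1)) +
      (if 3 \<le> j then \<Sum>k=1..\<nu> (j - 2). potential_flow a \<nu> Z (Init (j - 2) k) else 0)"
  proof (cases "i = 0")
    case True
    then show ?thesis using i assms by (simp add: potential_flow_def min_def)
  next
    case False
    then have "(if 3 \<le> j then \<Sum>k=1..\<nu> (j - 2). potential_flow a \<nu> Z (Init (j - 2) k) else 0) =
        Z (a + 1 + east_steps \<nu> i) - Z (a + 1 + east_steps \<nu> (i - 1))"
      using i sum_potential_flow_Init[of i a \<nu> Z] by simp
    then show ?thesis
      using i False by (cases "i = a") (simp_all add: potential_flow_def)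
  qed
qed

lemma conserves_cong:
  assumes "\<forall>\<alpha>\<in>arcs (car a \<nu>). y \<alpha> = y' \<alpha>"
  shows "conserves a \<nu> t y \<longleftrightarrow> conserves a \<nu> t y'"
proof -
  have y: "\<And>i k. i \<in> {1..a} \<Longrightarrow> k \<in> {1..\<nu> i} \<Longrightarrow> y (Init i k) = y' (Init i k)"
    "\<And>i. i \<in> {2..a + 1} \<Longrightarrow> y (Final i) = y' (Final i)"
    "\<And>j. j \<in> {1..a + 2} \<Longrightarrow> y (Path j) = y' (Path j)"
    using assms unfolding ball_arcs_car by blast+
  have "y (Path 1) = y' (Path 1)"
    "(\<Sum>i=1..a. \<Sum>k=1..\<nu> i. y (Init i k)) = (\<Sum>i=1..a. \<Sum>k=1..\<nu> i. y' (Init i k))"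
    using y by (auto intro!: sum.cong)
  moreover have "y (Path j) = y' (Path j)" "y (Path (j - 1)) = y' (Path (j - 1))"
    "j \<le> a + 1 \<Longrightarrow> y (Final j) = y' (Final j)"
    "3 \<le> j \<Longrightarrow> (\<Sum>k=1..\<nu> (j - 2). y (Init (j - 2) k)) = (\<Sum>k=1..\<nu> (j - 2). y' (Init (j - 2) k))"
    if "j \<in> {2..a + 2}" for j
  proof -
    have "j - 1 \<in> {1..a + 2}" "j \<in> {1..a + 2}" using that by auto
    then show "y (Path j) = y' (Path j)" "y (Path (j - 1)) = y' (Path (j - 1))"
      using y(3) by blast+
    show "y (Final j) = y' (Final j)" if "j \<le> a + 1"
      using that \<open>j \<in> {2..a + 2}\<close> by (intro y(2)) simp
    show "(\<Sum>k=1..\<nu> (j - 2). y (Init (j - 2) k)) = (\<Sum>k=1..\<nu> (j - 2). y' (Init (j - 2) k))"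
      if "3 \<le> j"
    proof (rule sum.cong)
      have "j - 2 \<in> {1..a}" using that \<open>j \<in> {2..a + 2}\<close> by auto
      then show "y (Init (j - 2) k) = y' (Init (j - 2) k)" if "k \<in> {1..\<nu> (j - 2)}" for k
        using that by (rule y(1))
    qed simp
  qed
  ultimately show ?thesis by (simp add: conserves_def)
qed

text \<open>
  Partial sums of the flow on the edges \<open>Final\<close> and \<open>Init\<close> define \<open>Z\<close>.  By construction
  its flow agrees with \<open>y\<close> on these edges and on \<open>Path 1\<close>; conservation at the vertices \<open>2, 3, \<dots>\<close> in turn
  determines the flow on the remaining path edges, and conservation at the source the total.
\<close>

lemma conserves_imp_potential:
  assumes "1 \<le> a" and y: "conserves a \<nu> t y"
  obtains Z where "Z 0 = 0" "Z (a + 1 + east_steps \<nu> a) = t"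
    "\<forall>\<alpha>\<in>arcs (car a \<nu>). y \<alpha> = potential_flow a \<nu> Z \<alpha>"
proof -
  let ?ix = "\<lambda>(i, k). east_steps \<nu> (i - 1) + k"
  let ?I = "SIGMA i:{1..a}. {1..\<nu> i}"
  have "inj_on ?ix ?I"
  proof (rule inj_onI)
    fix u v assume "u \<in> ?I" "v \<in> ?I" "?ix u = ?ix v"
    then show "u = v"
      using east_index_inj[of \<nu> "fst u" "snd u" "fst v" "snd v"]
      by (cases u; cases v) simp
  qed
  then have g: "inv_into ?I ?ix (east_steps \<nu> (i - 1) + k) = (i, k)" if "i \<in> {1..a}" "k \<in> {1..\<nu> i}" for i k
    using that inv_into_f_f[of ?ix ?I "(i, k)"] by auto
  \<comment> \<open>The flow on the \<open>l\<close>-th edge out of the source, not counting \<open>Path 1\<close>.\<close>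
  define g where "g = (\<lambda>l. case inv_into ?I ?ix l of (i, k) \<Rightarrow> y (Init i k))"
  define Z where "Z = (\<lambda>m. if m \<le> a then \<Sum>i=2..m + 1. y (Final i)
    else y (Path 1) + (\<Sum>l=1..m - (a + 1). g l))"
  have Z0: "Z 0 = 0" by (simp add: Z_def)
  have Init: "y (Init i k) = potential_flow a \<nu> Z (Init i k)" if ik: "i \<in> {1..a}" "k \<in> {1..\<nu> i}" for i k
  proof -
    obtain k' where k': "k = Suc k'" using ik by (cases k) auto
    let ?l = "east_steps \<nu> (i - 1) + k'"
    have "potential_flow a \<nu> Z (Init i k) = Z (a + 1 + Suc ?l) - Z (a + 1 + ?l)"
      by (simp add: potential_flow_def k' ac_simps)
    also have "\<dots> = g (Suc ?l)" by (simp add: Z_def)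
    also have "Suc ?l = east_steps \<nu> (i - 1) + k" by (simp add: k')
    also have "g \<dots> = y (Init i k)" unfolding g_def g[OF ik] by simp
    finally show ?thesis by (rule sym)
  qed
  have Final: "y (Final i) = potential_flow a \<nu> Z (Final i)" if i: "i \<in> {2..a + 1}" for i
  proof -
    obtain i' where i': "i = Suc (Suc i')" using i by (cases i; cases "i - 1") auto
    then show ?thesis using i by (simp add: potential_flow_def Z_def)
  qed
  have Path1: "y (Path 1) = potential_flow a \<nu> Z (Path 1)"
    using assms by (simp add: potential_flow_def Z_def)
  have Z: "conserves a \<nu> (Z (a + 1 + east_steps \<nu> a)) (potential_flow a \<nu> Z)"
    by (rule conserves_potential_flow) (use assms Z0 in simp_all)
  have Path: "j + 1 \<le> a + 2 \<Longrightarrow> y (Path (j + 1)) = potential_flow a \<nu> Z (Path (j + 1))" for j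
  proof (induction j)
    case 0
    then show ?case using Path1 by simp
  next
    case (Suc j)
    let ?j = "j + 2"
    have j: "?j \<in> {2..a + 2}" using Suc.prems by simp
    have eq: "z (Path ?j) = z (Path (j + 1)) + (if 3 \<le> ?j then \<Sum>k=1..\<nu> j. z (Init j k) else 0)
        - (if ?j \<le> a + 1 then z (Final ?j) else 0)" if "conserves a \<nu> s z" for z s
      using that j unfolding conserves_def by fastforce
    have "(if 3 \<le> ?j then \<Sum>k=1..\<nu> j. y (Init j k) else 0) =
        (if 3 \<le> ?j then \<Sum>k=1..\<nu> j. potential_flow a \<nu> Z (Init j k) else 0)"
      using j Init by (auto intro!: sum.cong)
    moreover have "(if ?j \<le> a + 1 then y (Final ?j) else 0) =
        (if ?j \<le> a + 1 then potential_flow a \<nu> Z (Final ?j) else 0)"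
      using Final by simp
    moreover have "y (Path (j + 1)) = potential_flow a \<nu> Z (Path (j + 1))"
      using Suc by simp
    ultimately have "y (Path ?j) = potential_flow a \<nu> Z (Path ?j)"
      unfolding eq[OF y] eq[OF Z] by simp
    then show ?case by simp
  qed
  have all: "\<forall>\<alpha>\<in>arcs (car a \<nu>). y \<alpha> = potential_flow a \<nu> Z \<alpha>"
    unfolding ball_arcs_car
  proof (intro conjI ballI)
    fix j assume "j \<in> {1..a + 2}"
    then show "y (Path j) = potential_flow a \<nu> Z (Path j)"
      using Path[of "j - 1"] by simp
  qed (use Init Final in auto)
  have "Z (a + 1 + east_steps \<nu> a) = t"
    using Z y conserves_cong[OF all, of t] by (simp add: conserves_def)
  then show thesis using that Z0 all by blast
qed

lemma sum_out_arcs_source: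
  "(\<Sum>\<alpha>\<in>out_arcs (car a \<nu>) 1. y \<alpha>) = y (Path 1) + (\<Sum>i=1..a. \<Sum>k=1..\<nu> i. y (Init i k))"
proof -
  let ?I = "SIGMA i:{1..a}. {1..\<nu> i}"
  have "out_arcs (car a \<nu>) 1 = insert (Path 1) ((\<lambda>(i, k). Init i k) ` ?I)"
    by (auto simp: out_arcs_def car_def)
  moreover have "(\<Sum>\<alpha>\<in>(\<lambda>(i, k). Init i k) ` ?I. y \<alpha>) = (\<Sum>(i, k)\<in>?I. y (Init i k))"
    by (subst sum.reindex) (auto simp: inj_on_def case_prod_beta)
  ultimately show ?thesis
    by (simp add: image_iff split_def sum.Sigma)
qed

lemma sum_out_arcs_inner:
  assumes "j \<in> {2..a + 2}"
  shows "(\<Sum>\<alpha>\<in>out_arcs (car a \<nu>) j. y \<alpha>) = y (Path j) + (if j \<le> a + 1 then y (Final j) else 0)"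
proof -
  have "out_arcs (car a \<nu>) j = insert (Path j) (if j \<le> a + 1 then {Final j} else {})"
    using assms by (auto simp: out_arcs_def car_def)
  then show ?thesis by simp
qed

lemma sum_in_arcs_inner:
  assumes "j \<in> {2..a + 2}"
  shows "(\<Sum>\<alpha>\<in>in_arcs (car a \<nu>) j. y \<alpha>) =
    y (Path (j - 1)) + (if 3 \<le> j then \<Sum>k=1..\<nu> (j - 2). y (Init (j - 2) k) else 0)"
proof -
  have "in_arcs (car a \<nu>) j = insert (Path (j - 1)) (if 3 \<le> j then Init (j - 2) ` {1..\<nu> (j - 2)} else {})"
    using assms by (auto simp: in_arcs_def car_def image_iff)
  moreover have "(\<Sum>\<alpha>\<in>Init (j - 2) ` {1..\<nu> (j - 2)}. y \<alpha>) = (\<Sum>k=1..\<nu> (j - 2). y (Init (j - 2) k))"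
    by (subst sum.reindex) (auto simp: inj_on_def)
  ultimately show ?thesis by (auto simp: image_iff)
qed

text \<open>
  The \<open>t\<close>-fold dilated order polytope, in terms of potentials.  Only the values up to position
  \<open>a + 1 + b\<close> matter for the flow; the others are arbitrary.
\<close>

definition potentials :: "nat \<Rightarrow> (nat \<Rightarrow> nat) \<Rightarrow> real \<Rightarrow> (nat \<Rightarrow> real) set" where
  "potentials a \<nu> t = {Z. Z 0 = 0 \<and> Z (a + 1 + east_steps \<nu> a) = t \<and>
     (\<forall>\<alpha>\<in>arcs (car a \<nu>). 0 \<le> potential_flow a \<nu> Z \<alpha>)}"

definition flow_vector ::
    "nat \<Rightarrow> (nat \<Rightarrow> nat) \<Rightarrow> ('e::finite \<Rightarrow> car_edge) \<Rightarrow> (nat \<Rightarrow> real) \<Rightarrow> real ^ 'e" where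
  "flow_vector a \<nu> \<epsilon> Z = (\<chi> e. potential_flow a \<nu> Z (\<epsilon> e))"

text \<open>
  The flows of total 1 are those of potentials; the bijection \<open>\<epsilon>\<close> translates between edges and the
  coordinates indexed by \<open>'e\<close>.
\<close>

lemma flow_polytope_eq_potentials:
  fixes \<epsilon> :: "'e::finite \<Rightarrow> car_edge"
  assumes "1 \<le> a" and bij: "bij_betw \<epsilon> UNIV (arcs (car a \<nu>))"
  shows "flow_polytope (a + 2) (car a \<nu>) \<epsilon> = flow_vector a \<nu> \<epsilon> ` potentials a \<nu> 1"
proof -
  let ?G = "car a \<nu>"
  have inj: "inv \<epsilon> (\<epsilon> e) = e" for e using bij by (simp add: bij_betw_def)
  have surj: "\<epsilon> (inv \<epsilon> \<alpha>) = \<alpha>" if "\<alpha> \<in> arcs ?G" for \<alpha>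
    using bij that by (metis bij_betw_def f_inv_into_f)
  have arc: "\<epsilon> e \<in> arcs ?G" for e using bij by (auto simp: bij_betw_def)
  have sum: "(\<Sum>e\<in>\<epsilon> -` A. x $ e) = (\<Sum>\<alpha>\<in>A. x $ inv \<epsilon> \<alpha>)" if "A \<subseteq> arcs ?G" for A and x :: "real ^ 'e"
    by (rule sum.reindex_bij_witness[of _ "inv \<epsilon>" \<epsilon>]) (use inj surj that in auto)
  have iff: "x \<in> flow_polytope (a + 2) ?G \<epsilon> \<longleftrightarrow> (\<forall>e. 0 \<le> x $ e) \<and> conserves a \<nu> 1 (\<lambda>\<alpha>. x $ inv \<epsilon> \<alpha>)" for x
  proof -
    have "out_arcs ?G j \<subseteq> arcs ?G" "in_arcs ?G j \<subseteq> arcs ?G" for j by auto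
    note this[THEN sum]
    then show ?thesis
      unfolding flow_polytope_def conserves_def mem_Collect_eq
      by (simp only: sum_out_arcs_source sum_out_arcs_inner sum_in_arcs_inner cong: ball_cong)
  qed
  show ?thesis
  proof (intro equalityI subsetI)
    fix x assume "x \<in> flow_polytope (a + 2) ?G \<epsilon>"
    then have nonneg: "\<forall>e. 0 \<le> x $ e" and "conserves a \<nu> 1 (\<lambda>\<alpha>. x $ inv \<epsilon> \<alpha>)"
      using iff by auto
    then obtain Z where Z: "Z 0 = 0" "Z (a + 1 + east_steps \<nu> a) = 1"
      "\<forall>\<alpha>\<in>arcs ?G. x $ inv \<epsilon> \<alpha> = potential_flow a \<nu> Z \<alpha>"
      using conserves_imp_potential[OF assms(1)] by blast
    have "x = flow_vector a \<nu> \<epsilon> Z"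
      using Z(3) arc inj by (auto simp: flow_vector_def vec_eq_iff) metis
    moreover have "Z \<in> potentials a \<nu> 1"
      using Z nonneg by (auto simp: potentials_def) metis
    ultimately show "x \<in> flow_vector a \<nu> \<epsilon> ` potentials a \<nu> 1" by blast
  next
    fix x assume "x \<in> flow_vector a \<nu> \<epsilon> ` potentials a \<nu> 1"
    then obtain Z where Z: "Z \<in> potentials a \<nu> 1" "x = flow_vector a \<nu> \<epsilon> Z" by blast
    have "\<forall>\<alpha>\<in>arcs ?G. x $ inv \<epsilon> \<alpha> = potential_flow a \<nu> Z \<alpha>"
      using surj by (simp add: Z(2) flow_vector_def)
    moreover have "conserves a \<nu> 1 (potential_flow a \<nu> Z)"
      using conserves_potential_flow[OF assms(1), of Z \<nu>] Z(1) by (simp add: potentials_def)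
    ultimately have "conserves a \<nu> 1 (\<lambda>\<alpha>. x $ inv \<epsilon> \<alpha>)"
      by (simp add: conserves_cong[where y = "\<lambda>\<alpha>. x $ inv \<epsilon> \<alpha>" and y' = "potential_flow a \<nu> Z"])
    moreover have "\<forall>e. 0 \<le> x $ e"
      using Z arc by (auto simp: flow_vector_def potentials_def)
    ultimately show "x \<in> flow_polytope (a + 2) ?G \<epsilon>" using iff by blast
  qed
qed

section \<open>Lattice points of the dilated flow polytope\<close>

lemma index_le:
  "\<forall>\<alpha>\<in>arcs (car a \<nu>). top_index a \<nu> \<alpha> \<le> a + 1 + east_steps \<nu> a \<and> bottom_index a \<nu> \<alpha> \<le> a + 1 + east_steps \<nu> a"
  unfolding ball_arcs_car
proof (intro conjI ballI)
  fix i k assume "i \<in> {1..a}" "k \<in> {1..\<nu> i}"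
  then have "east_steps \<nu> (i - 1) + k \<le> east_steps \<nu> a" using east_index_less by blast
  then show "top_index a \<nu> (Init i k) \<le> a + 1 + east_steps \<nu> a"
    "bottom_index a \<nu> (Init i k) \<le> a + 1 + east_steps \<nu> a" by simp_all
next
  fix j assume "j \<in> {1..a + 2}"
  then have "east_steps \<nu> (j - 2) \<le> east_steps \<nu> a" by (intro east_steps_mono) auto
  then show "top_index a \<nu> (Path j) \<le> a + 1 + east_steps \<nu> a" by simp
qed auto

lemma potential_flow_cong:
  assumes "\<And>m. m \<le> a + 1 + east_steps \<nu> a \<Longrightarrow> Z m = Z' m" "\<alpha> \<in> arcs (car a \<nu>)"
  shows "potential_flow a \<nu> Z \<alpha> = potential_flow a \<nu> Z' \<alpha>"
  using assms index_le[of a \<nu>] by (simp add: potential_flow_def)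

lemma potentials_iff:
  "Z \<in> potentials a \<nu> t \<longleftrightarrow> Z 0 = 0 \<and> Z (a + 1 + east_steps \<nu> a) = t \<and>
     (\<forall>i<a. Z i \<le> Z (Suc i)) \<and>
     (\<forall>l<east_steps \<nu> a. Z (a + 1 + l) \<le> Z (a + 1 + Suc l)) \<and>
     (\<forall>j\<in>{1..a + 2}. Z (min (j - 1) a) \<le> Z (a + 1 + east_steps \<nu> (j - 2)))"
  unfolding potentials_def mem_Collect_eq ball_potential_flow[where Q = "\<lambda>x. 0 \<le> x"]
  by (simp only: diff_ge_0_iff_ge)

text \<open>
  From each entry of \<open>F\<close> the chain of inequalities leads up to \<open>F\<^sub>a\<close>, then by the edge \<open>Path (a + 2)\<close>
  to \<open>U\<^sub>b = t\<close>; the entries of \<open>U\<close> lead to \<open>U\<^sub>b\<close> directly.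
\<close>

lemma potential_bounds:
  assumes Z: "Z \<in> potentials a \<nu> t" and m: "m \<le> a + 1 + east_steps \<nu> a"
  shows "0 \<le> Z m" "Z m \<le> t"
proof -
  have "Z m \<in> {0..}"
    by (rule potential_in_closed_set[of Z _ a \<nu> m]) (use Z m in \<open>auto simp: potentials_def\<close>)
  then show "0 \<le> Z m" by simp
  let ?N = "a + 1 + east_steps \<nu> a"
  have N: "Z ?N = t" and steps: "\<forall>i<a. Z i \<le> Z (Suc i)"
    "\<forall>l<east_steps \<nu> a. Z (a + 1 + l) \<le> Z (a + 1 + Suc l)"
    and cross: "\<forall>j\<in>{1..a + 2}. Z (min (j - 1) a) \<le> Z (a + 1 + east_steps \<nu> (j - 2))"
    using Z unfolding potentials_iff by blast+
  have u: "Z (a + 1 + l) \<le> t" if "l \<le> east_steps \<nu> a" for l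
    using that
  proof (induction rule: inc_induct)
    case base
    then show ?case using N by simp
  next
    case (step l)
    have "Z (a + 1 + l) \<le> Z (a + 1 + Suc l)" using steps(2) step.hyps by blast
    then show ?case using step.IH by linarith
  qed
  have f: "Z i \<le> t" if "i \<le> a" for i
    using that
  proof (induction rule: inc_induct)
    case base
    have "a + 2 \<in> {1..a + 2}" by simp
    then have "Z (min (a + 2 - 1) a) \<le> Z (a + 1 + east_steps \<nu> (a + 2 - 2))" using cross by blast
    then show ?case using N by simp
  next
    case (step i)
    have "Z i \<le> Z (Suc i)" using steps(1) step.hyps by blast
    then show ?case using step.IH by linarith
  qed
  show "Z m \<le> t"
    using f[of m] u[of "m - (a + 1)"] m by (cases "m \<le> a") auto
qed

lemma flow_vector_inject:
  assumes "bij_betw \<epsilon> UNIV (arcs (car a \<nu>))"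
    and "flow_vector a \<nu> \<epsilon> Z = flow_vector a \<nu> \<epsilon> Z'" "Z 0 = 0" "Z' 0 = 0"
    and m: "m \<le> a + 1 + east_steps \<nu> a"
  shows "Z m = Z' m"
proof -
  have "potential_flow a \<nu> Z \<alpha> = potential_flow a \<nu> Z' \<alpha>" if "\<alpha> \<in> arcs (car a \<nu>)" for \<alpha>
  proof -
    have "\<alpha> \<in> range \<epsilon>" using assms(1) that by (simp add: bij_betw_def)
    then obtain e where "\<alpha> = \<epsilon> e" by blast
    then show ?thesis using assms(2) by (simp add: flow_vector_def vec_eq_iff)
  qed
  then have "\<forall>\<alpha>\<in>arcs (car a \<nu>). potential_flow a \<nu> (\<lambda>m. Z m - Z' m) \<alpha> \<in> {0}"
    by (simp add: potential_flow_def algebra_simps)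
  then have "Z m - Z' m \<in> {0}"
    by (rule potential_in_closed_set[of "\<lambda>m. Z m - Z' m", rotated 3]) (use assms in simp_all)
  then show ?thesis by simp
qed

lemma flow_vector_scale: "flow_vector a \<nu> \<epsilon> (\<lambda>m. c * Z m) = c *\<^sub>R flow_vector a \<nu> \<epsilon> Z"
  by (simp add: flow_vector_def potential_flow_def vec_eq_iff algebra_simps)

lemma potentials_scale:
  "0 \<le> c \<Longrightarrow> Z \<in> potentials a \<nu> s \<Longrightarrow> (\<lambda>m. c * Z m) \<in> potentials a \<nu> (c * s)"
  by (auto simp: potentials_def potential_flow_def mult_left_mono)

text \<open>
  These are the vertices of the simplex given by the linear extension that puts all of \<open>F\<close> before all
  of \<open>U\<close>.  One of them shows that the polytope is nonempty; all together they determine its dimension.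
\<close>

lemma step_potential: "1 \<le> i \<Longrightarrow> i \<le> a + 1 + east_steps \<nu> a \<Longrightarrow> (\<lambda>m. if i \<le> m then 1 else 0) \<in> potentials a \<nu> 1"
  by (auto simp: potentials_iff)

text \<open>
  For \<open>t > 0\<close> potentials can be rescaled.  For \<open>t = 0\<close> the left side is \<open>{0}\<close> because the polytope is
  nonempty, and so is the right side, because a potential
  of total 0 vanishes at all positions that enter the flow.
\<close>

lemma scaled_flow_polytope:
  assumes "1 \<le> a" and bij: "bij_betw \<epsilon> UNIV (arcs (car a \<nu>))"
  shows "(\<lambda>x. real t *\<^sub>R x) ` flow_polytope (a + 2) (car a \<nu>) \<epsilon> =
    flow_vector a \<nu> \<epsilon> ` potentials a \<nu> (real t)"
  unfolding flow_polytope_eq_potentials[OF assms]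
proof (intro equalityI subsetI)
  fix x assume "x \<in> (\<lambda>x. real t *\<^sub>R x) ` flow_vector a \<nu> \<epsilon> ` potentials a \<nu> 1"
  then obtain Z where "Z \<in> potentials a \<nu> 1" "x = flow_vector a \<nu> \<epsilon> (\<lambda>m. real t * Z m)"
    by (auto simp: flow_vector_scale)
  then show "x \<in> flow_vector a \<nu> \<epsilon> ` potentials a \<nu> (real t)"
    using potentials_scale[of "real t" Z a \<nu> 1] by simp
next
  fix x assume "x \<in> flow_vector a \<nu> \<epsilon> ` potentials a \<nu> (real t)"
  then obtain Z where Z: "Z \<in> potentials a \<nu> (real t)" "x = flow_vector a \<nu> \<epsilon> Z" by blast
  show "x \<in> (\<lambda>x. real t *\<^sub>R x) ` flow_vector a \<nu> \<epsilon> ` potentials a \<nu> 1"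
  proof (cases "t = 0")
    case True
    have "\<epsilon> e \<in> arcs (car a \<nu>)" for e using bij by (auto simp: bij_betw_def)
    moreover have "Z m = 0" if "m \<le> a + 1 + east_steps \<nu> a" for m
      using potential_bounds[OF Z(1) that] True by simp
    ultimately have "potential_flow a \<nu> Z (\<epsilon> e) = potential_flow a \<nu> (\<lambda>_. 0) (\<epsilon> e)" for e
      by (intro potential_flow_cong) simp_all
    then have x: "x = real t *\<^sub>R flow_vector a \<nu> \<epsilon> (\<lambda>m. if 1 \<le> m then 1 else 0)"
      using True by (simp add: Z(2) flow_vector_def potential_flow_def vec_eq_iff)
    show ?thesis
      unfolding x by (intro imageI step_potential) simp_all
  next
    case False
    then have "x = real t *\<^sub>R flow_vector a \<nu> \<epsilon> (\<lambda>m. inverse (real t) * Z m)"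
      by (simp add: Z(2) flow_vector_scale)
    moreover have "(\<lambda>m. inverse (real t) * Z m) \<in> potentials a \<nu> 1"
      using potentials_scale[of "inverse (real t)" Z a \<nu> "real t"] Z(1) False by simp
    ultimately show ?thesis by blast
  qed
qed

definition chain_potential :: "nat \<Rightarrow> nat list \<times> nat list \<Rightarrow> nat \<Rightarrow> real" where
  "chain_potential t = (\<lambda>(F, U) m. real ((0 # F @ U @ [t]) ! m))"

lemma chain_potential_simps:
  "chain_potential t (F, U) 0 = 0"
  "i < length F \<Longrightarrow> chain_potential t (F, U) (Suc i) = real (F ! i)"
  "length F = a \<Longrightarrow> chain_potential t (F, U) (a + 1 + l) = real ((U @ [t]) ! l)"
  by (auto simp: chain_potential_def nth_append)

text \<open>
  The condition for \<open>j = 1\<close> is \<open>0 \<le> U\<^sub>0\<close> and the one for \<open>j = a + 2\<close> is \<open>F\<^sub>a \<le> t\<close>; those in between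
  are the links between the two chains.
\<close>

lemma chain_potential_in_potentials_iff:
  assumes F: "length F = a" and U: "length U = east_steps \<nu> a"
  shows "chain_potential t (F, U) \<in> potentials a \<nu> (real t) \<longleftrightarrow> (F, U) \<in> chain_pairs a \<nu> t"
proof -
  let ?Z = "chain_potential t (F, U)"
  have Z: "?Z 0 = 0" "\<And>i. i < a \<Longrightarrow> ?Z (Suc i) = real (F ! i)" "\<And>l. ?Z (a + 1 + l) = real ((U @ [t]) ! l)"
    using chain_potential_simps F by simp_all
  have last: "?Z (a + 1 + east_steps \<nu> a) = t"
    unfolding Z(3) by (metis U nth_append_length)
  have "(\<forall>i<a. ?Z i \<le> ?Z (Suc i)) \<longleftrightarrow> sorted F"
  proof
    assume *: "\<forall>i<a. ?Z i \<le> ?Z (Suc i)"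
    have "F ! i \<le> F ! Suc i" if "Suc i < a" for i
      using *[rule_format, OF that] that by (simp add: Z)
    then show "sorted F" using F by (simp add: sorted_iff_nth_Suc)
  next
    assume "sorted F"
    then have *: "F ! i \<le> F ! Suc i" if "Suc i < a" for i
      using that F by (simp add: sorted_iff_nth_Suc)
    show "\<forall>i<a. ?Z i \<le> ?Z (Suc i)"
    proof (intro allI impI)
      fix i assume "i < a"
      then show "?Z i \<le> ?Z (Suc i)" using * by (cases i) (simp_all add: Z)
    qed
  qed
  moreover have "(\<forall>l<east_steps \<nu> a. ?Z (a + 1 + l) \<le> ?Z (a + 1 + Suc l)) \<longleftrightarrow> sorted (U @ [t])"
    unfolding Z(3) sorted_iff_nth_Suc of_nat_le_iff by (simp add: U)
  moreover have "(\<forall>j\<in>{1..a + 2}. ?Z (min (j - 1) a) \<le> ?Z (a + 1 + east_steps \<nu> (j - 2))) \<longleftrightarrow>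
      (\<forall>j<a. F ! j \<le> (U @ [t]) ! east_steps \<nu> j) \<and> ?Z a \<le> t"
  proof (intro iffI conjI allI impI ballI)
    assume *: "\<forall>j\<in>{1..a + 2}. ?Z (min (j - 1) a) \<le> ?Z (a + 1 + east_steps \<nu> (j - 2))"
    show "F ! j \<le> (U @ [t]) ! east_steps \<nu> j" if "j < a" for j
      using *[rule_format, of "j + 2"] that by (simp add: Z(2) Z(3)[simplified])
    show "?Z a \<le> t"
      using *[rule_format, of "a + 2"] last by simp
  next
    fix j assume *: "(\<forall>j<a. F ! j \<le> (U @ [t]) ! east_steps \<nu> j) \<and> ?Z a \<le> t" and j: "j \<in> {1..a + 2}"
    consider "j = 1" | i where "j = i + 2" "i < a" | "j = a + 2"
    proof -
      have "j = 1 \<or> (j = (j - 2) + 2 \<and> j - 2 < a) \<or> j = a + 2" using j by auto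
      then show thesis using that by blast
    qed
    then show "?Z (min (j - 1) a) \<le> ?Z (a + 1 + east_steps \<nu> (j - 2))"
    proof cases
      case 1
      then show ?thesis unfolding Z(3) by (simp add: Z(1))
    next
      case 2
      then show ?thesis unfolding Z(3) using * by (simp add: Z(2))
    next
      case 3
      then show ?thesis using * last by simp
    qed
  qed
  ultimately have iff: "?Z \<in> potentials a \<nu> (real t) \<longleftrightarrow>
      sorted F \<and> sorted (U @ [t]) \<and> (\<forall>j<a. F ! j \<le> (U @ [t]) ! east_steps \<nu> j) \<and> ?Z a \<le> t"
    unfolding potentials_iff using Z(1) last by simp
  have bound: "\<forall>f\<in>set F. f \<le> t" if "sorted (U @ [t])" "\<forall>j<a. F ! j \<le> (U @ [t]) ! east_steps \<nu> j"
  proof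
    fix f assume "f \<in> set F"
    then obtain j where j: "j < a" "f = F ! j" using F by (auto simp: in_set_conv_nth)
    have "east_steps \<nu> j \<le> east_steps \<nu> a" using j by (intro east_steps_mono) simp
    then have "(U @ [t]) ! east_steps \<nu> j \<in> set (U @ [t])" by (intro nth_mem) (simp add: U)
    then have "(U @ [t]) ! east_steps \<nu> j \<le> t" using that(1) by (auto simp: sorted_append)
    then show "f \<le> t" using that(2) j le_trans by blast
  qed
  have "?Z a \<le> t" if "\<forall>f\<in>set F. f \<le> t"
    using that F Z(1,2) by (cases a) auto
  then show ?thesis
    unfolding iff using F U bound by (auto simp: chain_pairs_def sorted_append)
qed

lemma potential_of_nats:
  assumes Z0: "Z 0 = 0" and nats: "\<And>m. m \<le> a + 1 + b \<Longrightarrow> Z m \<in> \<nat>" and last: "Z (a + 1 + b) = real t"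
  obtains F U where "length F = a" "length U = b"
    "\<And>m. m \<le> a + 1 + b \<Longrightarrow> chain_potential t (F, U) m = Z m"
proof -
  obtain z where z: "\<And>m. m \<le> a + 1 + b \<Longrightarrow> Z m = real (z m)"
    using nats unfolding Nats_def image_iff by metis
  let ?F = "map (\<lambda>i. z (Suc i)) [0..<a]" and ?U = "map (\<lambda>l. z (a + 1 + l)) [0..<b]"
  have "chain_potential t (?F, ?U) m = Z m" if m: "m \<le> a + 1 + b" for m
  proof -
    consider "m = 0" | i where "m = Suc i" "i < a" | l where "m = a + 1 + l" "l < b" | "m = a + 1 + b"
    proof -
      have "m = 0 \<or> (m = Suc (m - 1) \<and> m - 1 < a) \<or> (m = a + 1 + (m - (a + 1)) \<and> m - (a + 1) < b) \<or> m = a + 1 + b"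
        using m by auto
      then show thesis using that by blast
    qed
    then show ?thesis
    proof cases
      case 1
      then show ?thesis using Z0 by (simp add: chain_potential_simps)
    next
      case 2
      then show ?thesis using z[OF m] by (simp add: chain_potential_simps)
    next
      case 3
      have "chain_potential t (?F, ?U) m = real ((?U @ [t]) ! l)"
        unfolding 3 by (rule chain_potential_simps) simp
      then show ?thesis using 3 z[OF m] by (simp add: nth_append)
    next
      case 4
      have "chain_potential t (?F, ?U) m = real ((?U @ [t]) ! b)"
        unfolding 4 by (rule chain_potential_simps) simp
      then show ?thesis using 4 last by (simp add: nth_append)
    qed
  qed
  then show thesis using that[of ?F ?U] by simp
qed

text \<open>
  A flow vector determines its potential, and an integral nonnegative flow has a potential with natural
  numbers as values, because these are sums of flows on edges.
\<close>

lemma ehrhart_flow_polytope: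
  fixes \<epsilon> :: "'e::finite \<Rightarrow> car_edge"
  assumes "1 \<le> a" and bij: "bij_betw \<epsilon> UNIV (arcs (car a \<nu>))"
  shows "ehrhart (flow_polytope (a + 2) (car a \<nu>) \<epsilon>) t = card (chain_pairs a \<nu> t)"
proof -
  let ?h = "\<lambda>c. flow_vector a \<nu> \<epsilon> (chain_potential t c)"
  let ?X = "{x \<in> flow_vector a \<nu> \<epsilon> ` potentials a \<nu> (real t). \<forall>e. x $ e \<in> \<int>}"
  let ?N = "a + 1 + east_steps \<nu> a"
  have arc: "\<epsilon> e \<in> arcs (car a \<nu>)" for e using bij by (auto simp: bij_betw_def)
  have "bij_betw ?h (chain_pairs a \<nu> t) ?X"
    unfolding bij_betw_def
  proof (intro conjI inj_onI equalityI subsetI)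
    fix c c' assume c: "c \<in> chain_pairs a \<nu> t" "c' \<in> chain_pairs a \<nu> t" and "?h c = ?h c'"
    obtain F U F' U' where FU: "c = (F, U)" "c' = (F', U')" by fastforce
    have len: "length F = a" "length U = east_steps \<nu> a" "length F' = a" "length U' = east_steps \<nu> a"
      using c by (auto simp: FU chain_pairs_def)
    have "chain_potential t c m = chain_potential t c' m" if "m \<le> ?N" for m
      by (rule flow_vector_inject[OF bij, of "chain_potential t c" "chain_potential t c'" m])
        (use \<open>?h c = ?h c'\<close> that in \<open>auto simp: FU chain_potential_simps\<close>)
    then have "(0 # F @ U @ [t]) ! m = (0 # F' @ U' @ [t]) ! m" if "m \<le> ?N" for m
      using that by (simp add: FU chain_potential_def)
    then have "0 # F @ U @ [t] = 0 # F' @ U' @ [t]"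
      using len by (intro nth_equalityI) auto
    then show "c = c'" using len by (simp add: FU)
  next
    fix x assume "x \<in> ?h ` chain_pairs a \<nu> t"
    then obtain F U where FU: "(F, U) \<in> chain_pairs a \<nu> t" "x = ?h (F, U)" by auto
    then have "chain_potential t (F, U) \<in> potentials a \<nu> (real t)"
      by (subst chain_potential_in_potentials_iff) (auto simp: chain_pairs_def)
    then show "x \<in> ?X"
      by (auto simp: FU flow_vector_def potential_flow_def chain_potential_def)
  next
    fix x assume "x \<in> ?X"
    then obtain Z where Z: "Z \<in> potentials a \<nu> (real t)" "x = flow_vector a \<nu> \<epsilon> Z" and int: "\<forall>e. x $ e \<in> \<int>"
      by auto
    have "potential_flow a \<nu> Z \<alpha> \<in> \<nat>" if "\<alpha> \<in> arcs (car a \<nu>)" for \<alpha>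
    proof -
      have "\<alpha> \<in> range \<epsilon>" using bij that by (simp add: bij_betw_def)
      then obtain e where e: "\<alpha> = \<epsilon> e" by blast
      have "x $ e \<in> \<int>" using int by blast
      then have "potential_flow a \<nu> Z \<alpha> \<in> \<int>" by (simp add: Z(2) flow_vector_def e)
      moreover have "0 \<le> potential_flow a \<nu> Z \<alpha>" using Z(1) that by (simp add: potentials_def)
      ultimately show ?thesis by (simp add: Nats_altdef2)
    qed
    then have "\<forall>\<alpha>\<in>arcs (car a \<nu>). potential_flow a \<nu> Z \<alpha> \<in> \<nat>" by blast
    then have "Z m \<in> \<nat>" if "m \<le> ?N" for m
      by (rule potential_in_closed_set[of Z \<nat> a \<nu> m, rotated 3]) (use that Z(1) in \<open>auto simp: potentials_def\<close>)
    then obtain F U where FU: "length F = a" "length U = east_steps \<nu> a"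
      and eq: "\<And>m. m \<le> ?N \<Longrightarrow> chain_potential t (F, U) m = Z m"
      using Z(1) potential_of_nats[of Z a "east_steps \<nu> a" t] by (auto simp: potentials_def)
    have flow: "potential_flow a \<nu> (chain_potential t (F, U)) \<alpha> = potential_flow a \<nu> Z \<alpha>"
      if "\<alpha> \<in> arcs (car a \<nu>)" for \<alpha>
      using eq that by (rule potential_flow_cong)
    then have "chain_potential t (F, U) \<in> potentials a \<nu> (real t)"
      using Z(1) eq[of 0] eq[of ?N] by (simp add: potentials_def)
    then have "(F, U) \<in> chain_pairs a \<nu> t"
      using chain_potential_in_potentials_iff[OF FU] by simp
    moreover have "x = ?h (F, U)"
      using flow arc by (simp add: Z(2) flow_vector_def vec_eq_iff)
    ultimately show "x \<in> ?h ` chain_pairs a \<nu> t" by blast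
  qed
  then have "card (chain_pairs a \<nu> t) = card ?X" by (rule bij_betw_same_card)
  then show ?thesis
    unfolding ehrhart_def scaled_flow_polytope[OF assms] by simp
qed

section \<open>Dimension of the flow polytope\<close>

lemma flow_vector_sum:
  "flow_vector a \<nu> \<epsilon> (\<lambda>m. \<Sum>i\<in>I. c i * Z i m) = (\<Sum>i\<in>I. c i *\<^sub>R flow_vector a \<nu> \<epsilon> (Z i))"
  by (simp add: flow_vector_def potential_flow_def vec_eq_iff sum_subtractf algebra_simps)

lemma step_decomposition:
  fixes Z :: "nat \<Rightarrow> real"
  assumes "m \<le> N" "Z 0 = 0"
  shows "Z m = (\<Sum>i=1..N. (Z i - Z (i - 1)) * (if i \<le> m then 1 else 0))"
proof -
  have "(\<Sum>i=1..N. (Z i - Z (i - 1)) * (if i \<le> m then 1 else 0)) = (\<Sum>i\<in>{Suc 0..m}. Z i - Z (i - 1))"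
    using assms by (intro sum.mono_neutral_cong_right) auto
  also have "\<dots> = Z m - Z 0" by (rule sum_telescope'') simp
  finally show ?thesis using assms by simp
qed

text \<open>
  The flow vectors of the \<open>a + b + 1\<close> step functions lie in the polytope and are linearly independent.
  Each point of the polytope is a combination of them whose coefficients, the increments of its
  potential, sum to the total flow 1; hence they span its affine hull.
\<close>

lemma aff_dim_flow_polytope:
  fixes \<epsilon> :: "'e::finite \<Rightarrow> car_edge"
  assumes "1 \<le> a" and bij: "bij_betw \<epsilon> UNIV (arcs (car a \<nu>))"
  shows "aff_dim (flow_polytope (a + 2) (car a \<nu>) \<epsilon>) = int (a + east_steps \<nu> a)"
proof -
  let ?N = "a + 1 + east_steps \<nu> a"
  let ?P = "flow_polytope (a + 2) (car a \<nu>) \<epsilon>"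
  define step :: "nat \<Rightarrow> nat \<Rightarrow> real" where "step i m = (if i \<le> m then 1 else 0)" for i m
  define v where "v = (\<lambda>i. flow_vector a \<nu> \<epsilon> (step i))"
  let ?V = "v ` {1..?N}"
  have arc: "\<epsilon> e \<in> arcs (car a \<nu>)" for e using bij by (auto simp: bij_betw_def)
  have inj: "inj_on v {1..?N}"
  proof (rule inj_onI)
    fix i j assume ij: "i \<in> {1..?N}" "j \<in> {1..?N}" "v i = v j"
    have eq: "step i m = step j m" if "m \<le> ?N" for m
      by (rule flow_vector_inject[OF bij, of "step i" "step j" m]) (use ij that in \<open>simp_all add: v_def step_def\<close>)
    show "i = j"
      using eq[of i] eq[of j] ij by (auto simp: step_def split: if_splits)
  qed
  have indep: "independent ?V"
  proof
    assume "dependent ?V"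
    then obtain u where u: "\<exists>x\<in>?V. u x \<noteq> 0" "(\<Sum>x\<in>?V. u x *\<^sub>R x) = 0"
      by (auto simp: dependent_finite)
    define W where "W = (\<lambda>m. \<Sum>i=1..?N. u (v i) * step i m)"
    have "flow_vector a \<nu> \<epsilon> W = (\<Sum>i=1..?N. u (v i) *\<^sub>R v i)"
      unfolding W_def v_def by (rule flow_vector_sum)
    also have "\<dots> = (\<Sum>x\<in>?V. u x *\<^sub>R x)" using inj by (simp add: sum.reindex)
    also have "\<dots> = flow_vector a \<nu> \<epsilon> (\<lambda>_. 0)"
      using u by (simp add: flow_vector_def potential_flow_def vec_eq_iff)
    finally have "flow_vector a \<nu> \<epsilon> W = flow_vector a \<nu> \<epsilon> (\<lambda>_. 0)" .
    then have W: "W m = 0" if "m \<le> ?N" for m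
      by (rule flow_vector_inject[OF bij, of W "\<lambda>_. 0" m]) (use that in \<open>auto simp: W_def step_def\<close>)
    have "u (v i) = 0" if i: "i \<in> {1..?N}" for i
    proof -
      have "W i - W (i - 1) = (\<Sum>j=1..?N. if j = i then u (v j) else 0)"
        unfolding W_def sum_subtractf[symmetric]
        using i by (intro sum.cong) (auto simp: step_def)
      also have "\<dots> = u (v i)" using i by simp
      finally show ?thesis
        using W[of i] W[of "i - 1"] i by (cases i) simp_all
    qed
    then show False using u(1) by blast
  qed
  have sub: "?V \<subseteq> ?P"
  proof
    fix x assume "x \<in> ?V"
    then obtain i where "i \<in> {1..?N}" "x = v i" by blast
    moreover from this have "step i \<in> potentials a \<nu> 1"
      using step_potential[of i a \<nu>] by (simp add: step_def[abs_def])
    ultimately show "x \<in> ?P"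
      unfolding flow_polytope_eq_potentials[OF assms] v_def by blast
  qed
  have "?P \<subseteq> affine hull ?V"
  proof
    fix x assume "x \<in> ?P"
    then have "x \<in> flow_vector a \<nu> \<epsilon> ` potentials a \<nu> 1"
      by (simp only: flow_polytope_eq_potentials[OF assms])
    then obtain Z where Z: "Z \<in> potentials a \<nu> 1" "x = flow_vector a \<nu> \<epsilon> Z"
      by blast
    let ?c = "\<lambda>i. Z i - Z (i - 1)"
    have Z0: "Z 0 = 0" "Z ?N = 1" using Z(1) by (auto simp: potentials_def)
    have "Z m = (\<Sum>i=1..?N. ?c i * step i m)" if "m \<le> ?N" for m
      unfolding step_def using that Z0(1) by (rule step_decomposition)
    then have "potential_flow a \<nu> Z \<alpha> = potential_flow a \<nu> (\<lambda>m. \<Sum>i=1..?N. ?c i * step i m) \<alpha>"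
      if "\<alpha> \<in> arcs (car a \<nu>)" for \<alpha>
      using that by (rule potential_flow_cong)
    then have "x = flow_vector a \<nu> \<epsilon> (\<lambda>m. \<Sum>i=1..?N. ?c i * step i m)"
      using arc by (simp add: Z(2) flow_vector_def vec_eq_iff)
    also have "\<dots> = (\<Sum>i=1..?N. ?c i *\<^sub>R v i)"
      unfolding v_def by (rule flow_vector_sum)
    also have "\<dots> = (\<Sum>y\<in>?V. ?c (inv_into {1..?N} v y) *\<^sub>R y)"
      using inj by (simp add: sum.reindex)
    finally have x: "x = (\<Sum>y\<in>?V. ?c (inv_into {1..?N} v y) *\<^sub>R y)" .
    have "(\<Sum>y\<in>?V. ?c (inv_into {1..?N} v y)) = (\<Sum>i\<in>{Suc 0..?N}. ?c i)"
      using inj by (simp add: sum.reindex)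
    also have "\<dots> = Z ?N - Z 0" by (rule sum_telescope'') simp
    finally have "(\<Sum>y\<in>?V. ?c (inv_into {1..?N} v y)) = 1" using Z0 by simp
    then show "x \<in> affine hull ?V"
      using x by (auto simp: affine_hull_finite intro!: exI[of _ "\<lambda>y. ?c (inv_into {1..?N} v y)"])
  qed
  then have "aff_dim ?P \<le> aff_dim ?V"
    using aff_dim_subset aff_dim_affine_hull by metis
  moreover have "aff_dim ?V \<le> aff_dim ?P" using sub by (rule aff_dim_subset)
  moreover have "\<not> affine_dependent ?V"
    using indep affine_dependent_imp_dependent by blast
  then have "int (card ?V) = aff_dim ?V + 1" by (rule aff_dim_affine_independent)
  moreover have "card ?V = ?N" using inj by (simp add: card_image)
  ultimately show ?thesis by simp
qed

section \<open>The \<open>h\<^sup>*\<close>-polynomial\<close>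

theorem theorem1p4:
  fixes a b :: nat
    and \<nu> :: "nat \<Rightarrow> nat"
    and \<epsilon> :: "'e::finite \<Rightarrow> car_edge"
  assumes "a \<ge> 1"
    and "endpoint (nu_path a \<nu>) = (b, a)"
    and "bij_betw \<epsilon> UNIV (arcs (car a \<nu>))"
  shows "is_hstar_poly (flow_polytope (a + 2) (car a \<nu>) \<epsilon>) (narayana_poly (nu_path a \<nu>))"
proof -
  let ?D = "(1 - fps_X) ^ (a + east_steps \<nu> a + 1) :: real fps"
  let ?A = "Abs_fps (\<lambda>t. real (card (chain_pairs a \<nu> t)))"
  have "fps_nth ?D 0 \<noteq> 0" by (simp add: fps_power_zeroth)
  then have "?D \<noteq> 0" by auto
  then have "?A = fps_of_poly (narayana_poly (nu_path a \<nu>)) / ?D"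
    unfolding chain_pairs_fps[symmetric] by simp
  then show ?thesis
    unfolding is_hstar_poly_def
    by (simp only: ehrhart_flow_polytope[OF assms(1,3)] aff_dim_flow_polytope[OF assms(1,3)] nat_int)
qed

end
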